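(* Fix $p\in(0,1)$. For each $n\ge 2$, let $\mathsf{w}^{(n)}$ be the staircase reduced word $(s_{n-1})(s_{n-2}s_{n-1})\cdots(s_1s_2\cdots s_{n-1})$, and let $v^{(n)}$ be the random permutation in $\mathfrak{S}_n$ represented by $\mathsf{sub}_p(\mathsf{w}^{(n)})$. Then, as $n\to\infty$, \[\mathbb E(\mathrm{inv}(v^{(n)}))=\frac{2\sqrt{2}}{3\sqrt{\pi}}\sqrt{\frac{p}{1-p}}\,(1+o(1))\,n^{3/2}.\]
   Context: $\mathfrak{S}_n$ is the symmetric group of permutations of $\{1,\ldots,n\}$, and $s_i\in\mathfrak{S}_n$ is the adjacent transposition swapping $i$ and $i+1$. A word over $\{s_1,\ldots,s_{n-1}\}$ represents the permutation that is the product of its letters. For $w\in\mathfrak{S}_n$, $\mathrm{inv}(w)$ is the number of pairs $(j,j')$ with $1\leq j<j'\leq n$ and $w^{-1}(j)>w^{-1}(j')$. For a word $\mathsf{w}$, $\mathsf{sub}_p(\mathsf{w})$ is the random subword obtained by independently deleting each letter of $\mathsf{w}$ with probability $1-p$. In $\mathsf{w}^{(n)}$ the parentheses are only for clarity: the word is the concatenation, for $a=n-1,n-2,\ldots,1$ in this order, of the words $s_as_{a+1}\cdots s_{n-1}$. *)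

theory Defs
  imports "HOL-Probability.Probability" "HOL-Combinatorics.Combinatorics"
    "HOL-Library.Landau_Symbols"
begin

text \<open>
  Permutations of \<open>{1..n}\<close> are functions \<open>nat \<Rightarrow> nat\<close> that fix every point outside \<open>{1..n}\<close>.
  A word over \<open>{s\<^sub>1, \<dots>, s\<^bsub>n-1\<^esub>}\<close> is the list of the indices of its letters.
\<close>

definition adj_transp :: "nat \<Rightarrow> nat \<Rightarrow> nat" where
  "adj_transp i = Transposition.transpose i (i + 1)"

text \<open>
  The product of permutations is composition of functions. The opposite convention would
  replace the result by its inverse, which has equally many inversions.
\<close>

definition word_perm :: "nat list \<Rightarrow> nat \<Rightarrow> nat" where
  "word_perm ws = foldr (\<lambda>i \<sigma>. adj_transp i \<circ> \<sigma>) ws id"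

definition inversions :: "nat \<Rightarrow> (nat \<Rightarrow> nat) \<Rightarrow> nat" where
  "inversions n w = card {(j, j'). 1 \<le> j \<and> j < j' \<and> j' \<le> n \<and> inv w j > inv w j'}"

text \<open>Each letter is kept with probability \<open>p\<close>, independently of the others.\<close>

primrec sub_pmf :: "real \<Rightarrow> 'a list \<Rightarrow> 'a list pmf" where
  "sub_pmf p [] = return_pmf []"
| "sub_pmf p (x # xs) =
     do {
       keep \<leftarrow> bernoulli_pmf p;
       ys \<leftarrow> sub_pmf p xs;
       return_pmf (if keep then x # ys else ys)
     }"

definition staircase_word :: "nat \<Rightarrow> nat list" where
  "staircase_word n = concat (map (\<lambda>a. [a..<n]) (rev [1..<n]))"

definition random_perm :: "real \<Rightarrow> nat \<Rightarrow> (nat \<Rightarrow> nat) pmf" where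
  "random_perm p n = map_pmf word_perm (sub_pmf p (staircase_word n))"

lemma word_perm_permutes:
  assumes "set ws \<subseteq> {1..<n}"
  shows "word_perm ws permutes {1..n}"
  using assms
proof (induction ws)
  case Nil
  then show ?case by (simp add: word_perm_def permutes_def)
next
  case (Cons i ws)
  have "adj_transp i permutes {1..n}"
    unfolding adj_transp_def using Cons.prems by (intro permutes_swap_id) auto
  moreover have "word_perm ws permutes {1..n}"
    using Cons by simp
  ultimately have "adj_transp i \<circ> word_perm ws permutes {1..n}"
    by (rule permutes_compose[rotated])
  then show ?case
    by (simp add: word_perm_def comp_def)
qed

lemma set_sub_pmf: "ys \<in> set_pmf (sub_pmf p xs) \<Longrightarrow> set ys \<subseteq> set xs"
  by (induction xs arbitrary: ys) (fastforce split: if_splits)+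

lemma random_perm_permutes:
  assumes "v \<in> set_pmf (random_perm p n)"
  shows "v permutes {1..n}"
proof -
  obtain ys where ys: "ys \<in> set_pmf (sub_pmf p (staircase_word n))" "v = word_perm ys"
    using assms by (auto simp: random_perm_def)
  have "set (staircase_word n) \<subseteq> {1..<n}"
    by (auto simp: staircase_word_def)
  with set_sub_pmf[OF ys(1)] show ?thesis
    using ys(2) word_perm_permutes by blast
qed

end

theory Submission
  imports Defs "HOL-Real_Asymp.Real_Asymp"
begin

text \<open>
  Follow the positions of two values \<open>j < j'\<close> while the letters are applied one after the other.
  On antisymmetric functions such as \<open>sgn (y - x)\<close>, the joint transition operator of a letter
  coincides with that of two independent copies of the one-particle motion, so inversion
  probabilities can be computed as if both positions moved independently. Row by row, one
  position is a centred random walk with steps \<open>-1\<close> (probability \<open>p\<close>) or geometric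
  (probability \<open>1 - p\<close>), reflected at \<open>n\<close>. Reflection is negligible, and the expected number of
  inversions with first entry \<open>a\<close> becomes the mean of the positive part of the difference of two
  independent walks of length about \<open>a\<close>, which by Levy's continuity theorem is asymptotic to
  \<open>2 * sqrt (p / (1 - p)) * sqrt a / sqrt (2 * pi)\<close>. Summing over \<open>a < n\<close> gives the claim.
\<close>


text \<open>The decoupling is exact, but it is an identity of expectations and not of laws: two
  values never share a position, while independent particles can meet. Hence the weight 1/2 at ties,
  which makes the comparison antisymmetric about 1/2. The obstacle is the barrier at
  \<open>n\<close>. For rows \<open>a\<close> close to \<open>n\<close> the error bound is not small
  against \<open>sqrt n\<close>, so no estimate uniform in \<open>a\<close> is sought. Only the sum
  of the row errors matters: each is at most of order 1 + n / (n - a) powr (2/3), and these add up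
  to order n powr (4/3). Zero mean and finite second moments of the steps suffice for all error
  bounds. Origin of the constant: one step has variance 2p / (1 - p), so the difference of two walks
  gains 4p / (1 - p) per row, whence the factor 2 * sqrt (p / (1 - p)). The mean of the positive
  part of a standard normal variable is 1 / sqrt (2 * pi), and summing sqrt a over a < n contributes
  2/3.\<close>

lemma integral_bind_pmf_bounded:
  fixes f :: "'b \<Rightarrow> real"
  assumes "\<And>x. \<bar>f x\<bar> \<le> B"
  shows "measure_pmf.expectation (M \<bind> N) f = measure_pmf.expectation M (\<lambda>x. measure_pmf.expectation (N x) f)"
  unfolding measure_pmf_bind
  by (rule integral_bind[where K="count_space UNIV" and B'=1 and B=B])
     (auto intro!: assms prob_space_imp_subprob_space simp: space_subprob_algebra measure_pmf.prob_space_axioms measure_pmf.finite_measure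
       measure_pmf.emeasure_space_1 measure_pmf.emeasure_le_1)

lemma integrable_measure_pmf_bounded:
  fixes f :: "'b \<Rightarrow> 'c :: {banach, second_countable_topology}"
  assumes "\<And>x. norm (f x) \<le> B"
  shows "integrable (measure_pmf M) f"
  using assms by (intro measure_pmf.integrable_const_bound[where B=B]) auto

lemma norm_expectation_le:
  fixes f :: "'b \<Rightarrow> 'c :: {banach, second_countable_topology}"
  assumes "\<And>x. norm (f x) \<le> B"
  shows "norm (measure_pmf.expectation M f) \<le> B"
proof -
  have "norm (measure_pmf.expectation M f) \<le> measure_pmf.expectation M (\<lambda>x. norm (f x))"
    by (rule integral_norm_bound)
  also have "\<dots> \<le> measure_pmf.expectation M (\<lambda>_. B)"
    by (intro integral_mono integrable_measure_pmf_bounded[where B=B] integrable_measure_pmf_bounded[where B="norm B"])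
       (use assms in auto)
  finally show ?thesis by simp
qed

lemma integral_bind_bernoulli:
  fixes f :: "'b \<Rightarrow> real"
  assumes "\<And>x. \<bar>f x\<bar> \<le> B" "0 \<le> p" "p \<le> 1"
  shows "measure_pmf.expectation (bernoulli_pmf p \<bind> N) f
    = p * measure_pmf.expectation (N True) f + (1 - p) * measure_pmf.expectation (N False) f"
  using assms by (subst integral_bind_pmf_bounded[where B=B]) auto

section \<open>The motion of one value and of a pair of values through a random word\<close>

lemma adj_transp_apply: "adj_transp i x = (if x = i then i + 1 else if x = i + 1 then i else x)"
  by (simp add: adj_transp_def Transposition.transpose_def)

lemma bij_adj_transp: "bij (adj_transp i)"
  by (simp add: adj_transp_def)

lemma inv_adj_transp: "inv (adj_transp i) = adj_transp i"
  by (simp add: adj_transp_def)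

lemma bij_word_perm: "bij (word_perm ws)"
proof (induction ws)
  case (Cons i ws)
  have "word_perm (i # ws) = adj_transp i \<circ> word_perm ws"
    by (simp add: word_perm_def)
  then show ?case
    using Cons bij_adj_transp by (simp only: bij_comp)
qed (simp add: word_perm_def flip: id_def)

text \<open>Inversion reverses the composition, so the leftmost letter acts first on a value. List
  recursion therefore runs in the order in which the value moves.\<close>

lemma inv_word_perm_Cons: "inv (word_perm (i # ws)) x = inv (word_perm ws) (adj_transp i x)"
proof -
  have "word_perm (i # ws) = adj_transp i \<circ> word_perm ws"
    by (simp add: word_perm_def)
  then show ?thesis
    by (simp add: o_inv_distrib bij_adj_transp bij_word_perm inv_adj_transp)
qed

lemma inv_word_perm_Nil: "inv (word_perm []) x = x"
  by (simp add: word_perm_def)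

text \<open>One coin moves both coordinates, in contrast to two runs of \<open>pos_pmf\<close>. The
  expectation is given directly as a real recursion, so the comparison with independent motion
  becomes algebra in four real numbers.\<close>

primrec pair_exp :: "real \<Rightarrow> (nat \<Rightarrow> nat \<Rightarrow> real) \<Rightarrow> nat list \<Rightarrow> nat \<Rightarrow> nat \<Rightarrow> real" where
  "pair_exp p f [] x y = f x y"
| "pair_exp p f (i # ws) x y =
     p * pair_exp p f ws (adj_transp i x) (adj_transp i y) + (1 - p) * pair_exp p f ws x y"

primrec pos_pmf :: "real \<Rightarrow> nat list \<Rightarrow> nat \<Rightarrow> nat pmf" where
  "pos_pmf p [] x = return_pmf x"
| "pos_pmf p (i # ws) x = bernoulli_pmf p \<bind> (\<lambda>b. pos_pmf p ws (if b then adj_transp i x else x))"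

lemma expectation_sub_pmf:
  assumes "\<And>x y. \<bar>f x y\<bar> \<le> B" "0 \<le> p" "p \<le> 1"
  shows "measure_pmf.expectation (sub_pmf p ws) (\<lambda>vs. f (inv (word_perm vs) x) (inv (word_perm vs) y))
    = pair_exp p f ws x y"
proof (induction ws arbitrary: x y)
  case (Cons i ws)
  let ?g = "\<lambda>vs. f (inv (word_perm vs) x) (inv (word_perm vs) y)"
  have e: "sub_pmf p (i # ws) = bernoulli_pmf p \<bind> (\<lambda>b. map_pmf (\<lambda>vs. if b then i # vs else vs) (sub_pmf p ws))"
    by (simp add: map_pmf_def)
  have "measure_pmf.expectation (sub_pmf p (i # ws)) ?g =
      p * measure_pmf.expectation (sub_pmf p ws) (\<lambda>vs. ?g (i # vs)) + (1 - p) * measure_pmf.expectation (sub_pmf p ws) ?g"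
    unfolding e by (subst integral_bind_bernoulli[where B=B]) (simp_all add: assms)
  then show ?case
    by (simp only: inv_word_perm_Cons Cons pair_exp.simps)
qed (simp add: inv_word_perm_Nil)

lemma pair_exp_antisym:
  assumes "\<And>x y. f y x = - f x y"
  shows "pair_exp p f ws y x = - pair_exp p f ws x y"
proof (induction ws arbitrary: x y)
  case Nil
  show ?case using assms[of x y] by simp
next
  case (Cons i ws)
  show ?case
    using Cons[of x y] Cons[of "adj_transp i x" "adj_transp i y"] by simp
qed

lemma pair_exp_add_const:
  "pair_exp p (\<lambda>x y. f x y + c) ws x y = pair_exp p f ws x y + c"
  by (induction ws arbitrary: x y) (simp_all add: algebra_simps)

text \<open>Moving the two positions by the same letter or by independent copies of it differs only
  when the letter touches both of them, and antisymmetry makes this difference vanish.\<close>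

lemma pair_exp_eq_independent:
  assumes anti: "\<And>x y. f y x = - f x y" and bnd: "\<And>x y. \<bar>f x y\<bar> \<le> B" and p: "0 \<le> p" "p \<le> 1"
  shows "pair_exp p f ws x y =
    measure_pmf.expectation (pos_pmf p ws x) (\<lambda>u. measure_pmf.expectation (pos_pmf p ws y) (f u))"
proof (induction ws arbitrary: x y)
  case (Cons i ws)
  let ?h = "pair_exp p f ws"
  let ?s = "adj_transp i"
  have b1: "\<bar>measure_pmf.expectation M (f u)\<bar> \<le> B" for M u
    using norm_expectation_le[of "f u" B M] bnd by simp
  have "measure_pmf.expectation (pos_pmf p (i # ws) x) (\<lambda>u. measure_pmf.expectation (pos_pmf p (i # ws) y) (f u))
    = p * (p * ?h (?s x) (?s y) + (1 - p) * ?h (?s x) y) + (1 - p) * (p * ?h x (?s y) + (1 - p) * ?h x y)"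
  proof -
    have "measure_pmf.expectation (pos_pmf p (i # ws) x) (\<lambda>u. measure_pmf.expectation (pos_pmf p (i # ws) y) (f u))
      = p * measure_pmf.expectation (pos_pmf p ws (?s x)) (\<lambda>u. measure_pmf.expectation (pos_pmf p (i # ws) y) (f u))
        + (1 - p) * measure_pmf.expectation (pos_pmf p ws x) (\<lambda>u. measure_pmf.expectation (pos_pmf p (i # ws) y) (f u))"
      by (simp add: integral_bind_bernoulli[where B=B] b1 p del: pos_pmf.simps(2) add: pos_pmf.simps(2)[of p i ws x])
    moreover have "measure_pmf.expectation (pos_pmf p ws z) (\<lambda>u. measure_pmf.expectation (pos_pmf p (i # ws) y) (f u))
       = p * ?h z (?s y) + (1 - p) * ?h z y" for z
      by (simp add: integral_bind_bernoulli[where B=B] bnd p Cons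
           integrable_measure_pmf_bounded[where B=B] b1)
    ultimately show ?thesis by simp
  qed
  also have "\<dots> = p * ?h (?s x) (?s y) + (1 - p) * ?h x y
     - p * (1 - p) * (?h x y + ?h (?s x) (?s y) - ?h (?s x) y - ?h x (?s y))"
    by (simp add: algebra_simps)
  also have "?h x y + ?h (?s x) (?s y) - ?h (?s x) y - ?h x (?s y) = 0"
  proof -
    have 1: "?h u u = 0" for u using pair_exp_antisym[of f p ws u u, OF anti] by simp
    have 2: "?h u v = - ?h v u" for u v by (rule pair_exp_antisym[OF anti])
    \<comment> \<open>If the letter fixes one coordinate, the second difference cancels in pairs.
      Otherwise both lie in {i, i + 1}. The diagonal case \<open>y = x\<close> must be included
      because independent particles can meet; there, as in the swapped case, antisymmetry cancels
      the terms.\<close>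
    have "?s x = x \<or> ?s y = y \<or> y = x \<or> y = ?s x \<and> ?s y = x"
      by (auto simp: adj_transp_apply)
    then show ?thesis
      using 1 2[of "?s x" x] by auto
  qed
  finally show ?case by simp
qed simp

text \<open>Equal to 1/2 plus half the sign of x - y, so \<open>tie_gt x y - 1 / 2\<close> is
  antisymmetric and the decoupling applies. For two distinct values of one permutation a tie cannot
  occur, so the value 1/2 does not disturb the count of inversions.\<close>

definition tie_gt :: "'a::linorder \<Rightarrow> 'a \<Rightarrow> real" where
  "tie_gt x y = (if y < x then 1 else if x = y then 1 / 2 else 0)"

lemma tie_gt_bounds: "0 \<le> tie_gt x y" "tie_gt x y \<le> 1"
  by (auto simp: tie_gt_def)

lemma abs_tie_gt_le: "\<bar>tie_gt x y\<bar> \<le> 1"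
  using tie_gt_bounds[of x y] by linarith

lemma pair_exp_tie_gt:
  assumes p: "0 \<le> p" "p \<le> 1"
  shows "pair_exp p tie_gt ws x y =
    measure_pmf.expectation (pos_pmf p ws x) (\<lambda>u. measure_pmf.expectation (pos_pmf p ws y) (tie_gt u))"
proof -
  let ?f = "\<lambda>x y::nat. tie_gt x y - 1 / 2"
  have e: "tie_gt = (\<lambda>x y. ?f x y + 1 / 2)" by (auto simp: fun_eq_iff)
  have "pair_exp p tie_gt ws x y = pair_exp p ?f ws x y + 1 / 2"
    by (subst e, subst pair_exp_add_const) simp
  also have "pair_exp p ?f ws x y =
    measure_pmf.expectation (pos_pmf p ws x) (\<lambda>u. measure_pmf.expectation (pos_pmf p ws y) (?f u))"
    by (rule pair_exp_eq_independent[where B=2]) (auto simp: tie_gt_def p)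
  also have "\<dots> = measure_pmf.expectation (pos_pmf p ws x) (\<lambda>u. measure_pmf.expectation (pos_pmf p ws y) (tie_gt u)) - 1 / 2"
  proof -
    have i: "integrable (measure_pmf M) (tie_gt (u::nat))" for M u
      by (rule integrable_measure_pmf_bounded[where B=1]) (simp add: abs_tie_gt_le)
    have j: "integrable (measure_pmf M) (\<lambda>u. measure_pmf.expectation M' (tie_gt (u::nat)))" for M M'
      by (intro integrable_measure_pmf_bounded[where B=1] norm_expectation_le) (simp add: abs_tie_gt_le)
    show ?thesis by (simp add: i j)
  qed
  finally show ?thesis by simp
qed

section \<open>Expected inversions as a sum over rows\<close>

lemma finite_set_sub_pmf: "finite (set_pmf (sub_pmf p xs))"
  by (induction xs) auto

lemma inversions_eq_sum:
  assumes "bij w"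
  shows "real (inversions n w) = (\<Sum>j\<in>{1..<n}. \<Sum>j'\<in>{j<..n}. tie_gt (inv w j) (inv w j'))"
proof -
  have inj: "inj (inv w)" using assms by (simp add: bij_imp_bij_inv bij_is_inj)
  have "{(j, j'). 1 \<le> j \<and> j < j' \<and> j' \<le> n \<and> inv w j > inv w j'}
     = Sigma {1..<n} (\<lambda>j. {j' \<in> {j<..n}. inv w j > inv w j'})" by auto
  then have "real (inversions n w) = (\<Sum>j\<in>{1..<n}. real (card {j' \<in> {j<..n}. inv w j > inv w j'}))"
    by (simp add: inversions_def card_SigmaI)
  also have "\<dots> = (\<Sum>j\<in>{1..<n}. \<Sum>j'\<in>{j<..n}. tie_gt (inv w j) (inv w j'))"
  proof (intro sum.cong refl)
    fix j
    have "(\<Sum>j'\<in>{j<..n}. tie_gt (inv w j) (inv w j')) = (\<Sum>j'\<in>{j<..n}. of_bool (inv w j > inv w j'))"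
      using inj by (intro sum.cong) (auto simp: tie_gt_def dest: injD)
    then show "real (card {j' \<in> {j<..n}. inv w j > inv w j'}) = (\<Sum>j'\<in>{j<..n}. tie_gt (inv w j) (inv w j'))"
      by (simp add: Int_def conj_commute)
  qed
  finally show ?thesis .
qed

lemma sum_pair_exp_append:
  assumes "\<And>i. i \<in> set ws1 \<Longrightarrow> adj_transp i a = a" "\<And>i. i \<in> set ws1 \<Longrightarrow> adj_transp i permutes A"
  shows "(\<Sum>y\<in>A. pair_exp p f (ws1 @ ws2) a y) = (\<Sum>y\<in>A. pair_exp p f ws2 a y)"
  using assms
proof (induction ws1)
  case (Cons i ws1)
  have "(\<Sum>y\<in>A. pair_exp p f (ws1 @ ws2) a (adj_transp i y)) = (\<Sum>y\<in>A. pair_exp p f (ws1 @ ws2) a y)"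
    using sum.permute[OF Cons.prems(2)[of i], of "pair_exp p f (ws1 @ ws2) a"] by simp
  with Cons show ?case
    by (simp add: sum.distrib flip: sum_distrib_left) (simp add: algebra_simps)
qed simp

text \<open>The suffix of the staircase word that begins with row \<open>a\<close>, since rows come
  in decreasing order.\<close>

definition rows :: "nat \<Rightarrow> nat \<Rightarrow> nat list" where
  "rows n a = concat (map (\<lambda>a. [a..<n]) (rev [1..<Suc a]))"

lemma rows_simps: "rows n 0 = []" "rows n (Suc a) = [Suc a..<n] @ rows n a"
  by (simp_all add: rows_def)

text \<open>The rows before row \<open>a\<close> fix \<open>a\<close> and permute \<open>{a<..n}\<close>, so summing over the
  starting points in \<open>{a<..n}\<close> lets both positions start at the same row.\<close>

lemma expectation_inversions:
  assumes p: "0 \<le> p" "p \<le> 1"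
  shows "measure_pmf.expectation (random_perm p n) (\<lambda>v. real (inversions n v)) =
    (\<Sum>a\<in>{1..<n}. \<Sum>y\<in>{a<..n}. measure_pmf.expectation (pos_pmf p (rows n a) a)
       (\<lambda>u. measure_pmf.expectation (pos_pmf p (rows n a) y) (tie_gt u)))"
proof -
  have "measure_pmf.expectation (random_perm p n) (\<lambda>v. real (inversions n v)) =
    (\<Sum>a\<in>{1..<n}. \<Sum>y\<in>{a<..n}. pair_exp p tie_gt (staircase_word n) a y)"
    unfolding random_perm_def
    by (simp add: inversions_eq_sum bij_word_perm Bochner_Integration.integral_sum
        integrable_measure_pmf_finite finite_set_sub_pmf expectation_sub_pmf[where B=1] abs_tie_gt_le p)
  also have "\<dots> = (\<Sum>a\<in>{1..<n}. \<Sum>y\<in>{a<..n}. pair_exp p tie_gt (rows n a) a y)"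
  proof (rule sum.cong[OF refl])
    fix a assume a: "a \<in> {1..<n}"
    have "[1..<n] = [1..<Suc a] @ [Suc a..<n]"
      using a upt_add_eq_append[of 1 "Suc a" "n - Suc a"] by simp
    then have "staircase_word n = concat (map (\<lambda>a. [a..<n]) (rev [Suc a..<n])) @ rows n a"
      by (simp add: staircase_word_def rows_def)
    moreover have "adj_transp i permutes {a<..n}" if "a < i" "i < n" for i
      unfolding adj_transp_def using that by (intro permutes_swap_id) auto
    ultimately show "(\<Sum>y\<in>{a<..n}. pair_exp p tie_gt (staircase_word n) a y)
       = (\<Sum>y\<in>{a<..n}. pair_exp p tie_gt (rows n a) a y)"
      by (simp only:, intro sum_pair_exp_append) (auto simp: adj_transp_apply)
  qed
  finally show ?thesis
    by (simp add: pair_exp_tie_gt p)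
qed


section \<open>Expectations of unbounded functions\<close>

lemma integral_pmf_count_space:
  fixes f :: "'a \<Rightarrow> real"
  shows "integrable (measure_pmf M) f \<longleftrightarrow> integrable (count_space UNIV) (\<lambda>x. pmf M x * f x)"
    and "measure_pmf.expectation M f = (\<integral>x. pmf M x * f x \<partial>count_space UNIV)"
  unfolding measure_pmf_eq_density
  by (simp_all add: integrable_density integral_density)

lemma pmf_bind_bernoulli:
  assumes "0 \<le> p" "p \<le> 1"
  shows "pmf (bernoulli_pmf p \<bind> N) x = p * pmf (N True) x + (1 - p) * pmf (N False) x"
  using assms by (simp add: pmf_bind)

text \<open>For unbounded \<open>f\<close>, such as squares. Mixing over a coin makes the mass
  function a convex combination of two, so linearity of the integral against the counting measure is
  enough.\<close>

lemma expectation_bind_bernoulli_integrable: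
  fixes f :: "'b \<Rightarrow> real"
  assumes "integrable (measure_pmf (N True)) f" "integrable (measure_pmf (N False)) f" "0 \<le> p" "p \<le> 1"
  shows "integrable (measure_pmf (bernoulli_pmf p \<bind> N)) f"
    and "measure_pmf.expectation (bernoulli_pmf p \<bind> N) f
      = p * measure_pmf.expectation (N True) f + (1 - p) * measure_pmf.expectation (N False) f"
proof -
  have e: "pmf (bernoulli_pmf p \<bind> N) x * f x = p * (pmf (N True) x * f x) + (1 - p) * (pmf (N False) x * f x)" for x
    using assms by (simp add: pmf_bind_bernoulli algebra_simps)
  show "integrable (measure_pmf (bernoulli_pmf p \<bind> N)) f"
    using assms unfolding integral_pmf_count_space e by (intro Bochner_Integration.integrable_add integrable_mult_right) auto
  show "measure_pmf.expectation (bernoulli_pmf p \<bind> N) f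
      = p * measure_pmf.expectation (N True) f + (1 - p) * measure_pmf.expectation (N False) f"
    using assms unfolding integral_pmf_count_space e
    by (subst Bochner_Integration.integral_add) (auto intro!: integrable_mult_right)
qed

text \<open>Nonnegative integrals unfold through \<open>bind_pmf\<close> without prior
  integrability. Moment bounds are therefore proved there by induction and brought back in this
  way.\<close>

lemma expectation_le_of_nn_integral:
  fixes f :: "'a \<Rightarrow> real"
  assumes "\<And>x. 0 \<le> f x" "(\<integral>\<^sup>+x. ennreal (f x) \<partial>measure_pmf M) \<le> ennreal B" "0 \<le> B"
  shows "integrable (measure_pmf M) f" "measure_pmf.expectation M f \<le> B"
proof -
  show i: "integrable (measure_pmf M) f"
    using assms by (intro integrableI_nonneg) (auto intro: le_less_trans)
  have "ennreal (measure_pmf.expectation M f) = (\<integral>\<^sup>+x. ennreal (f x) \<partial>measure_pmf M)"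
    using i assms by (intro nn_integral_eq_integral[symmetric]) auto
  with assms show "measure_pmf.expectation M f \<le> B"
    by (metis ennreal_le_iff)
qed

lemma pos_pmf_append: "pos_pmf p (ws1 @ ws2) x = pos_pmf p ws1 x \<bind> pos_pmf p ws2"
  by (induction ws1 arbitrary: x) (simp_all add: bind_return_pmf bind_assoc_pmf)

lemma pos_pmf_fixed:
  assumes "\<And>i. i \<in> set ws \<Longrightarrow> adj_transp i x = x"
  shows "pos_pmf p ws x = return_pmf x"
  using assms by (induction ws) (simp_all cong: if_cong)

lemma bernoulli_pmf_flip:
  assumes "0 \<le> p" "p \<le> 1"
  shows "bernoulli_pmf (1 - p) \<bind> f = bernoulli_pmf p \<bind> (\<lambda>b. f (\<not> b))"
  using assms by (intro pmf_eqI) (simp add: pmf_bind)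

section \<open>One particle as a random walk with a barrier\<close>

definition step_pmf :: "real \<Rightarrow> int pmf" where
  "step_pmf p = bernoulli_pmf p \<bind> (\<lambda>b. if b then return_pmf (- 1) else map_pmf int (geometric_pmf (1 - p)))"

text \<open>The map \<open>\<phi>\<close> is applied after each step: \<open>min n\<close> gives the
  walk with the barrier, the identity gives the free walk, and both share their moment
  estimates.\<close>

primrec chain :: "real \<Rightarrow> (int \<Rightarrow> int) \<Rightarrow> nat \<Rightarrow> int \<Rightarrow> int pmf" where
  "chain p \<phi> 0 x = return_pmf x"
| "chain p \<phi> (Suc t) x = step_pmf p \<bind> (\<lambda>k. chain p \<phi> t (\<phi> (x + k)))"

text \<open>The value \<open>a\<close> enters row \<open>a\<close> at its very first letter. No
  earlier letter of that row can lower it, so its first move is purely geometric; the remaining rows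
  give ordinary steps.\<close>

definition start_chain :: "real \<Rightarrow> (int \<Rightarrow> int) \<Rightarrow> nat \<Rightarrow> int \<Rightarrow> int pmf" where
  "start_chain p \<phi> t x = geometric_pmf (1 - p) \<bind> (\<lambda>k. chain p \<phi> t (\<phi> (x + int k)))"

locale keep_probability =
  fixes p :: real
  assumes p0: "0 < p" and p1: "p < 1"
begin

abbreviation "geo \<equiv> geometric_pmf (1 - p)"

lemma geo_unfold:
  "geo = bernoulli_pmf p \<bind> (\<lambda>b. if b then map_pmf Suc geo else return_pmf 0)"
proof -
  have "geo = bernoulli_pmf (1 - p) \<bind> (\<lambda>b. if b then return_pmf 0 else map_pmf Suc geo)"
    using p0 p1 by (intro geometric_bind_pmf_unfold) auto
  also have "\<dots> = bernoulli_pmf p \<bind> (\<lambda>b. if \<not> b then return_pmf 0 else map_pmf Suc geo)"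
    using p0 p1 by (intro bernoulli_pmf_flip) auto
  also have "\<dots> = bernoulli_pmf p \<bind> (\<lambda>b. if b then map_pmf Suc geo else return_pmf 0)"
    by (intro bind_pmf_cong) auto
  finally show ?thesis .
qed

text \<open>A particle standing where the row currently acts is carried up by each kept letter. The
  first deleted letter leaves it behind for the rest of the row, so the rise is a geometric run
  length, cut off at the end of the row.\<close>

lemma pos_pmf_cursor:
  assumes "i \<le> n"
  shows "pos_pmf p [i..<n] i = map_pmf (\<lambda>k. min n (i + k)) geo"
  using assms
proof (induction "n - i" arbitrary: i)
  case 0
  then show ?case by simp
next
  case (Suc m)
  then have i: "i < n" by simp
  have 1: "pos_pmf p [Suc i..<n] i = return_pmf i"
    by (rule pos_pmf_fixed) (auto simp: adj_transp_apply)
  have 2: "pos_pmf p [Suc i..<n] (Suc i) = map_pmf (\<lambda>k. min n (Suc i + k)) geo"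
    using Suc i by (intro Suc.hyps(1)) auto
  have "pos_pmf p [i..<n] i = bernoulli_pmf p \<bind> (\<lambda>b. if b then map_pmf (\<lambda>k. min n (Suc i + k)) geo else return_pmf i)"
    using i 1 2 by (auto simp: upt_conv_Cons adj_transp_apply intro!: bind_pmf_cong)
  also have "\<dots> = map_pmf (\<lambda>k. min n (i + k)) (bernoulli_pmf p \<bind> (\<lambda>b. if b then map_pmf Suc geo else return_pmf 0))"
    using i by (auto simp: map_bind_pmf pmf.map_comp o_def intro!: bind_pmf_cong)
  finally show ?case by (simp only: geo_unfold[symmetric])
qed

text \<open>Letters before \<open>x - 1\<close> miss the particle. If letter \<open>x - 1\<close> is
  kept, it moves down and the rest of the row misses it; if it is deleted, the row reaches
  \<open>x\<close> with the particle there and the geometric rise starts.\<close>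

lemma pos_pmf_row:
  assumes "a < x" "x \<le> n"
  shows "pos_pmf p [a..<n] x = map_pmf (\<lambda>k. nat (min (int n) (int x + k))) (step_pmf p)"
proof -
  have "[a..<n] = [a..<x - 1] @ (x - 1) # [x..<n]"
    using assms upt_add_eq_append[of a "x - 1" "n - (x - 1)"] upt_conv_Cons[of "x - 1" n] by simp
  moreover have "pos_pmf p [a..<x - 1] x = return_pmf x"
    by (rule pos_pmf_fixed) (auto simp: adj_transp_apply)
  moreover have "pos_pmf p [x..<n] (x - 1) = return_pmf (x - 1)"
    using assms by (intro pos_pmf_fixed) (auto simp: adj_transp_apply)
  moreover have "adj_transp (x - 1) x = x - 1"
    using assms by (auto simp: adj_transp_apply)
  ultimately have "pos_pmf p [a..<n] x =
      bernoulli_pmf p \<bind> (\<lambda>b. if b then return_pmf (x - 1) else map_pmf (\<lambda>k. min n (x + k)) geo)"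
    using assms by (auto simp: pos_pmf_append bind_return_pmf pos_pmf_cursor intro!: bind_pmf_cong)
  also have "\<dots> = map_pmf (\<lambda>k. nat (min (int n) (int x + k))) (step_pmf p)"
    unfolding step_pmf_def map_bind_pmf
  proof (intro bind_pmf_cong refl)
    fix b
    have "nat (min (int n) (int x - 1)) = x - 1" using assms by auto
    moreover have "nat (min (int n) (int x + int k)) = min n (x + k)" for k by auto
    ultimately show "(if b then return_pmf (x - 1) else map_pmf (\<lambda>k. min n (x + k)) geo)
      = map_pmf (\<lambda>k. nat (min (int n) (int x + k)))
           (if b then return_pmf (- 1) else map_pmf int (geometric_pmf (1 - p)))"
      by (auto simp: pmf.map_comp o_def)
  qed
  finally show ?thesis .
qed

lemma set_step_pmf: "k \<in> set_pmf (step_pmf p) \<Longrightarrow> - 1 \<le> k"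
  unfolding step_pmf_def by (auto split: if_splits)

text \<open>The hypothesis \<open>a < y\<close> survives each row: the position drops by at most
  one, and so does the row index. Hence the lower end is never felt, and the only boundary effect is
  at \<open>n\<close>.\<close>

lemma map_int_pos_pmf_rows:
  assumes "a < y" "y \<le> n"
  shows "map_pmf int (pos_pmf p (rows n a) y) = chain p (min (int n)) a (int y)"
  using assms
proof (induction a arbitrary: y)
  case (Suc a)
  have "map_pmf int (pos_pmf p (rows n (Suc a)) y) =
      step_pmf p \<bind> (\<lambda>k. map_pmf int (pos_pmf p (rows n a) (nat (min (int n) (int y + k)))))"
    using Suc.prems by (simp only: rows_simps pos_pmf_append pos_pmf_row map_bind_pmf bind_map_pmf)
  also have "\<dots> = step_pmf p \<bind> (\<lambda>k. chain p (min (int n)) a (min (int n) (int y + k)))"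
  proof (intro bind_pmf_cong refl)
    fix k assume "k \<in> set_pmf (step_pmf p)"
    then have k: "- 1 \<le> k" by (rule set_step_pmf)
    have "int (nat (min (int n) (int y + k))) = min (int n) (int y + k)"
      using k Suc.prems by simp
    moreover have "map_pmf int (pos_pmf p (rows n a) (nat (min (int n) (int y + k))))
      = chain p (min (int n)) a (int (nat (min (int n) (int y + k))))"
      using k Suc.prems by (intro Suc.IH) auto
    ultimately show "map_pmf int (pos_pmf p (rows n a) (nat (min (int n) (int y + k))))
      = chain p (min (int n)) a (min (int n) (int y + k))" by simp
  qed
  finally show ?case by simp
qed (simp add: rows_simps)

lemma map_int_pos_pmf_rows_start:
  assumes "0 < a" "a \<le> n"
  shows "map_pmf int (pos_pmf p (rows n a) a) = start_chain p (min (int n)) (a - 1) (int a)"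
proof -
  obtain a' where a': "a = Suc a'" using assms by (cases a) auto
  have "map_pmf int (pos_pmf p (rows n a) a) = geo \<bind> (\<lambda>k. map_pmf int (pos_pmf p (rows n a') (min n (a + k))))"
    using assms unfolding a' by (simp only: rows_simps pos_pmf_append pos_pmf_cursor map_bind_pmf bind_map_pmf)
  also have "\<dots> = geo \<bind> (\<lambda>k. chain p (min (int n)) a' (min (int n) (int a + int k)))"
  proof (intro bind_pmf_cong refl)
    fix k
    have "map_pmf int (pos_pmf p (rows n a') (min n (a + k))) = chain p (min (int n)) a' (int (min n (a + k)))"
      using assms a' by (intro map_int_pos_pmf_rows) auto
    then show "map_pmf int (pos_pmf p (rows n a') (min n (a + k))) = chain p (min (int n)) a' (min (int n) (int a + int k))"
      by (simp add: of_nat_min)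
  qed
  finally show ?thesis by (simp add: start_chain_def a')
qed

section \<open>First and second moments of the walks\<close>

lemma integrable_geo: "integrable (measure_pmf geo) real"
  using p0 p1 by (intro integrable_real_geometric_pmf) auto

lemma expectation_geo: "measure_pmf.expectation geo real = p / (1 - p)"
  using p0 p1 by (subst expectation_geometric_pmf) auto

lemma integrable_geo_square: "integrable (measure_pmf geo) (\<lambda>k. (real k)\<^sup>2)"
proof -
  \<comment> \<open>Differentiating the geometric series twice gives the coefficients (n + 1) * (n +
    2), which dominate the square of n.\<close>
  have s0: "summable (\<lambda>n. (\<lambda>_. 1) n * x ^ n)" if "norm x < 1" for x :: real
    using that by (simp add: summable_geometric)
  have s1: "summable (\<lambda>n. diffs (\<lambda>_. 1) n * x ^ n)" if "norm x < 1" for x :: real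
    using that s0 by (rule termdiff_converges)
  have s2: "summable (\<lambda>n. diffs (diffs (\<lambda>_. 1)) n * p ^ n)"
    by (rule termdiff_converges[where K=1]) (use p0 p1 s1 in auto)
  have "summable (\<lambda>n. norm ((1 - (1 - p)) ^ n * (1 - p) * (real n)\<^sup>2))"
  proof (rule summable_comparison_test'[OF s2])
    fix n :: nat
    have "(real n)\<^sup>2 * (1 - p) \<le> (real n)\<^sup>2 * 1" using p0 p1 by (intro mult_left_mono) auto
    also have "\<dots> \<le> (1 + real n) * (2 + real n)" by (simp add: algebra_simps power2_eq_square)
    finally have "(real n)\<^sup>2 * (1 - p) * p ^ n \<le> (1 + real n) * (2 + real n) * p ^ n"
      using p0 by (intro mult_right_mono) auto
    then show "norm (norm ((1 - (1 - p)) ^ n * (1 - p) * (real n)\<^sup>2)) \<le> diffs (diffs (\<lambda>_. 1)) n * p ^ n"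
      using p0 p1 by (simp add: diffs_def abs_mult mult_ac)
  qed
  then show ?thesis
    using p0 p1 by (subst integral_pmf_count_space(1)) (simp add: integrable_count_space_nat_iff)
qed

definition geo_var :: real where "geo_var = measure_pmf.expectation geo (\<lambda>k. (real k)\<^sup>2)"
definition step_var :: real where "step_var = measure_pmf.expectation (step_pmf p) (\<lambda>k. (real_of_int k)\<^sup>2)"

lemma geo_var_nonneg: "0 \<le> geo_var" and step_var_nonneg: "0 \<le> step_var"
  by (simp_all add: geo_var_def step_var_def)

text \<open>The drop by 1 with weight p balances the geometric mean p / (1 - p) with weight 1 - p.
  This centring is what makes second moments grow linearly in the number of rows.\<close>

lemma integrable_step: "integrable (measure_pmf (step_pmf p)) real_of_int"
  and expectation_step: "measure_pmf.expectation (step_pmf p) real_of_int = 0"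
proof -
  have i: "integrable (measure_pmf (map_pmf int geo)) real_of_int"
    using integrable_geo by simp
  have "measure_pmf.expectation (map_pmf int geo) real_of_int = p / (1 - p)"
    using expectation_geo by simp
  then show "integrable (measure_pmf (step_pmf p)) real_of_int"
    "measure_pmf.expectation (step_pmf p) real_of_int = 0"
    unfolding step_pmf_def
    using i p0 p1 by (simp_all add: expectation_bind_bernoulli_integrable integrable_measure_pmf_finite del: integral_map_pmf)
qed

lemma integrable_step_square: "integrable (measure_pmf (step_pmf p)) (\<lambda>k. (real_of_int k)\<^sup>2)"
  unfolding step_pmf_def
  using integrable_geo_square p0 p1
  by (intro expectation_bind_bernoulli_integrable) (simp_all add: integrable_measure_pmf_finite)

lemma step_quadratic:
  "integrable (measure_pmf (step_pmf p)) (\<lambda>k. (z + real_of_int k)\<^sup>2 + c)"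
  "measure_pmf.expectation (step_pmf p) (\<lambda>k. (z + real_of_int k)\<^sup>2 + c) = z\<^sup>2 + step_var + c"
proof -
  have e: "(\<lambda>k. (z + real_of_int k)\<^sup>2 + c) = (\<lambda>k. (real_of_int k)\<^sup>2 + 2 * z * real_of_int k + (z\<^sup>2 + c))"
    by (auto simp: power2_eq_square algebra_simps)
  show "integrable (measure_pmf (step_pmf p)) (\<lambda>k. (z + real_of_int k)\<^sup>2 + c)"
    unfolding e using integrable_step integrable_step_square by (intro Bochner_Integration.integrable_add) auto
  show "measure_pmf.expectation (step_pmf p) (\<lambda>k. (z + real_of_int k)\<^sup>2 + c) = z\<^sup>2 + step_var + c"
    unfolding e using integrable_step integrable_step_square expectation_step by (simp add: step_var_def)
qed


text \<open>A map that does not increase the distance to \<open>c\<close> can only lower the second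
  moment about \<open>c\<close>, and each centred step adds \<open>step_var\<close>. The hypothesis
  covers the identity for every \<open>c\<close> and the barrier \<open>min n\<close> for
  \<open>c \<le> n\<close>.\<close>

lemma chain_second_moment:
  assumes \<phi>: "\<And>z. \<bar>\<phi> z - c\<bar> \<le> \<bar>z - c\<bar>"
  shows "integrable (measure_pmf (chain p \<phi> t x)) (\<lambda>z. (real_of_int (z - c))\<^sup>2)"
    and "measure_pmf.expectation (chain p \<phi> t x) (\<lambda>z. (real_of_int (z - c))\<^sup>2) \<le> (real_of_int (x - c))\<^sup>2 + step_var * t"
proof -
  have nn: "(\<integral>\<^sup>+z. ennreal ((real_of_int (z - c))\<^sup>2) \<partial>chain p \<phi> t x) \<le> ennreal ((real_of_int (x - c))\<^sup>2 + step_var * t)"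
  proof (induction t arbitrary: x)
    case (Suc t)
    have "(\<integral>\<^sup>+z. ennreal ((real_of_int (z - c))\<^sup>2) \<partial>chain p \<phi> (Suc t) x)
       \<le> (\<integral>\<^sup>+k. ennreal ((real_of_int (\<phi> (x + k) - c))\<^sup>2 + step_var * t) \<partial>step_pmf p)"
      using Suc by (auto intro!: nn_integral_mono)
    also have "\<dots> \<le> (\<integral>\<^sup>+k. ennreal ((real_of_int (x - c) + real_of_int k)\<^sup>2 + step_var * t) \<partial>step_pmf p)"
    proof (intro nn_integral_mono ennreal_leI add_right_mono)
      fix k
      have "\<bar>real_of_int (\<phi> (x + k) - c)\<bar> \<le> \<bar>real_of_int (x + k - c)\<bar>"
        using \<phi>[of "x + k"] by linarith
      then show "(real_of_int (\<phi> (x + k) - c))\<^sup>2 \<le> (real_of_int (x - c) + real_of_int k)\<^sup>2"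
        by (simp add: abs_le_square_iff algebra_simps)
    qed
    also have "\<dots> = ennreal ((real_of_int (x - c))\<^sup>2 + step_var + step_var * t)"
      using step_quadratic[of "real_of_int (x - c)" "step_var * t"] step_var_nonneg
      by (subst nn_integral_eq_integral) auto
    finally show ?case by (simp add: algebra_simps)
  qed simp
  show "integrable (measure_pmf (chain p \<phi> t x)) (\<lambda>z. (real_of_int (z - c))\<^sup>2)"
    "measure_pmf.expectation (chain p \<phi> t x) (\<lambda>z. (real_of_int (z - c))\<^sup>2) \<le> (real_of_int (x - c))\<^sup>2 + step_var * t"
    using expectation_le_of_nn_integral[OF _ nn] step_var_nonneg by simp_all
qed

lemma geo_quadratic:
  "integrable (measure_pmf geo) (\<lambda>k. (real k)\<^sup>2 + c)"
  "measure_pmf.expectation geo (\<lambda>k. (real k)\<^sup>2 + c) = geo_var + c"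
  using integrable_geo_square by (simp_all add: geo_var_def)

lemma start_chain_second_moment:
  assumes \<phi>: "\<And>z. \<bar>\<phi> z - x\<bar> \<le> \<bar>z - x\<bar>"
  shows "integrable (measure_pmf (start_chain p \<phi> t x)) (\<lambda>z. (real_of_int (z - x))\<^sup>2)"
    and "measure_pmf.expectation (start_chain p \<phi> t x) (\<lambda>z. (real_of_int (z - x))\<^sup>2) \<le> geo_var + step_var * t"
proof -
  have nn: "(\<integral>\<^sup>+z. ennreal ((real_of_int (z - x))\<^sup>2) \<partial>start_chain p \<phi> t x) \<le> ennreal (geo_var + step_var * t)"
  proof -
    have "(\<integral>\<^sup>+z. ennreal ((real_of_int (z - x))\<^sup>2) \<partial>start_chain p \<phi> t x)
      = (\<integral>\<^sup>+k. (\<integral>\<^sup>+z. ennreal ((real_of_int (z - x))\<^sup>2) \<partial>chain p \<phi> t (\<phi> (x + int k))) \<partial>geo)"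
      by (simp add: start_chain_def)
    also have "\<dots> \<le> (\<integral>\<^sup>+k. ennreal ((real k)\<^sup>2 + step_var * t) \<partial>geo)"
    proof (rule nn_integral_mono)
      fix k
      have "(\<integral>\<^sup>+z. ennreal ((real_of_int (z - x))\<^sup>2) \<partial>chain p \<phi> t (\<phi> (x + int k)))
        = ennreal (measure_pmf.expectation (chain p \<phi> t (\<phi> (x + int k))) (\<lambda>z. (real_of_int (z - x))\<^sup>2))"
        by (intro nn_integral_eq_integral chain_second_moment \<phi>) auto
      also have "\<dots> \<le> ennreal ((real_of_int (\<phi> (x + int k) - x))\<^sup>2 + step_var * t)"
        by (intro ennreal_leI chain_second_moment \<phi>)
      also have "\<dots> \<le> ennreal ((real k)\<^sup>2 + step_var * t)"
      proof (intro ennreal_leI add_right_mono)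
        have "\<bar>real_of_int (\<phi> (x + int k) - x)\<bar> \<le> \<bar>real k\<bar>"
          using \<phi>[of "x + int k"] by linarith
        then show "(real_of_int (\<phi> (x + int k) - x))\<^sup>2 \<le> (real k)\<^sup>2"
          by (simp only: abs_le_square_iff)
      qed
      finally show "(\<integral>\<^sup>+z. ennreal ((real_of_int (z - x))\<^sup>2) \<partial>chain p \<phi> t (\<phi> (x + int k)))
        \<le> ennreal ((real k)\<^sup>2 + step_var * t)" .
    qed
    also have "\<dots> = ennreal (geo_var + step_var * t)"
      using geo_quadratic[of "step_var * t"] step_var_nonneg
      by (subst nn_integral_eq_integral) auto
    finally show ?thesis .
  qed
  show "integrable (measure_pmf (start_chain p \<phi> t x)) (\<lambda>z. (real_of_int (z - x))\<^sup>2)"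
    "measure_pmf.expectation (start_chain p \<phi> t x) (\<lambda>z. (real_of_int (z - x))\<^sup>2) \<le> geo_var + step_var * t"
    using expectation_le_of_nn_integral[OF _ nn] step_var_nonneg geo_var_nonneg by simp_all
qed

section \<open>Removing the barrier\<close>

lemma expectation_unit_interval:
  fixes f :: "'a \<Rightarrow> real"
  assumes "\<And>z. 0 \<le> f z" "\<And>z. f z \<le> 1"
  shows "0 \<le> measure_pmf.expectation M f" "measure_pmf.expectation M f \<le> 1"
proof -
  show "0 \<le> measure_pmf.expectation M f" using assms by (simp add: integral_nonneg_AE)
  have "norm (measure_pmf.expectation M f) \<le> 1"
    using assms by (intro norm_expectation_le) simp
  then show "measure_pmf.expectation M f \<le> 1" by simp
qed

lemma expectation_diff_unit_interval:
  fixes f :: "'a \<Rightarrow> real"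
  assumes "\<And>z. 0 \<le> f z" "\<And>z. f z \<le> 1"
  shows "\<bar>measure_pmf.expectation M f - measure_pmf.expectation M' f\<bar> \<le> 1"
  using expectation_unit_interval[of f M, OF assms] expectation_unit_interval[of f M', OF assms] by linarith

text \<open>A coupling argument: both processes take the same first step drawn from
  \<open>M\<close>, so the errors of the continuations are averaged over it.\<close>

lemma expectation_bind_diff_le:
  fixes f :: "'a \<Rightarrow> real" and M :: "'b pmf"
  assumes f: "\<And>z. 0 \<le> f z" "\<And>z. f z \<le> 1"
    and B: "integrable (measure_pmf M) B"
    and le: "\<And>k. \<bar>measure_pmf.expectation (N k) f - measure_pmf.expectation (N' k) f\<bar> \<le> B k"
  shows "\<bar>measure_pmf.expectation (M \<bind> N) f - measure_pmf.expectation (M \<bind> N') f\<bar>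
    \<le> measure_pmf.expectation M B"
proof -
  let ?E = "\<lambda>k. measure_pmf.expectation (N k) f"
  let ?F = "\<lambda>k. measure_pmf.expectation (N' k) f"
  have fb: "\<bar>f z\<bar> \<le> 1" for z using f[of z] by simp
  have i: "integrable (measure_pmf M) (\<lambda>k. measure_pmf.expectation (N k) f)" for N
    using expectation_unit_interval[of f, OF f] by (intro integrable_measure_pmf_bounded[where B=1]) simp
  have "measure_pmf.expectation (M \<bind> N) f - measure_pmf.expectation (M \<bind> N') f
      = measure_pmf.expectation M ?E - measure_pmf.expectation M ?F"
    by (simp only: integral_bind_pmf_bounded[where B=1, OF fb])
  also have "\<dots> = measure_pmf.expectation M (\<lambda>k. ?E k - ?F k)"
    by (rule Bochner_Integration.integral_diff[symmetric]) (rule i)+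
  also have "\<bar>\<dots>\<bar> \<le> measure_pmf.expectation M (\<lambda>k. \<bar>?E k - ?F k\<bar>)"
    by (rule integral_abs_bound)
  also have "\<dots> \<le> measure_pmf.expectation M B"
    using i le B by (intro integral_mono) auto
  finally show ?thesis .
qed

text \<open>A chain that never reaches the barrier \<open>n\<close> agrees with the free one. Beyond the barrier
  the quadratic bound exceeds \<open>1\<close>, so it is preserved by the martingale step without
  any maximal inequality.\<close>

lemma chain_barrier_error:
  fixes f :: "int \<Rightarrow> real"
  assumes f: "\<And>z. 0 \<le> f z" "\<And>z. f z \<le> 1" and an: "a < n"
  shows "\<bar>measure_pmf.expectation (chain p (min n) t (min n x)) f - measure_pmf.expectation (chain p (\<lambda>z. z) t x) f\<bar>
     \<le> ((real_of_int (x - a))\<^sup>2 + step_var * t) / (real_of_int (n - a))\<^sup>2"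
\<comment> \<open>The start \<open>x\<close> may lie above \<open>n\<close>, with the barrier walk
  started from \<open>min n x\<close>. This lets the induction hypothesis apply to every
  \<open>x + k\<close>, including steps that overshoot.\<close>
proof (induction t arbitrary: x)
  case 0
  show ?case
  proof (cases "x \<le> n")
    case False
    then have "(real_of_int (n - a))\<^sup>2 \<le> (real_of_int (x - a))\<^sup>2"
      using an by (intro power_mono) auto
    then have "1 \<le> (real_of_int (x - a))\<^sup>2 / (real_of_int (n - a))\<^sup>2"
      using an by (simp add: field_simps)
    moreover have "\<bar>f (min n x) - f x\<bar> \<le> 1"
      using f(1,2)[of "min n x"] f(1,2)[of x] by linarith
    ultimately show ?thesis by simp
  qed (auto simp: min_def)
next
  case (Suc t)
  show ?case
  proof (cases "x \<le> n")
    case False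
    then have "(real_of_int (n - a))\<^sup>2 \<le> (real_of_int (x - a))\<^sup>2"
      using an by (intro power_mono) auto
    also have "\<dots> \<le> (real_of_int (x - a))\<^sup>2 + step_var * Suc t"
      using step_var_nonneg by simp
    finally have "1 \<le> ((real_of_int (x - a))\<^sup>2 + step_var * Suc t) / (real_of_int (n - a))\<^sup>2"
      using an by (simp add: field_simps)
    moreover have "\<bar>measure_pmf.expectation M f - measure_pmf.expectation M' f\<bar> \<le> 1" for M M'
      using f by (rule expectation_diff_unit_interval)
    ultimately show ?thesis by (meson order_trans)
  next
    case True
    let ?B = "\<lambda>k. ((real_of_int (x - a) + real_of_int k)\<^sup>2 + step_var * t) / (real_of_int (n - a))\<^sup>2"
    have "\<bar>measure_pmf.expectation (step_pmf p \<bind> (\<lambda>k. chain p (min n) t (min n (x + k)))) f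
        - measure_pmf.expectation (step_pmf p \<bind> (\<lambda>k. chain p (\<lambda>z. z) t (x + k))) f\<bar>
      \<le> measure_pmf.expectation (step_pmf p) ?B"
    proof (rule expectation_bind_diff_le[of f, OF f])
      show "integrable (measure_pmf (step_pmf p)) ?B"
        by (intro integrable_divide_zero step_quadratic impI)
      show "\<bar>measure_pmf.expectation (chain p (min n) t (min n (x + k))) f
          - measure_pmf.expectation (chain p (\<lambda>z. z) t (x + k)) f\<bar> \<le> ?B k" for k
        using Suc[of "x + k"] by (simp add: algebra_simps)
    qed
    also have "\<dots> = ((real_of_int (x - a))\<^sup>2 + step_var * Suc t) / (real_of_int (n - a))\<^sup>2"
      using step_quadratic[of "real_of_int (x - a)" "step_var * t"] by (simp add: algebra_simps)
    finally show ?thesis using True by (simp add: min_absorb2)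
  qed
qed

lemma start_chain_barrier_error:
  fixes f :: "int \<Rightarrow> real"
  assumes f: "\<And>z. 0 \<le> f z" "\<And>z. f z \<le> 1" and an: "a < n"
  shows "\<bar>measure_pmf.expectation (start_chain p (min n) t a) f - measure_pmf.expectation (start_chain p (\<lambda>z. z) t a) f\<bar>
     \<le> (geo_var + step_var * t) / (real_of_int (n - a))\<^sup>2"
proof -
  let ?B = "\<lambda>k. ((real k)\<^sup>2 + step_var * t) / (real_of_int (n - a))\<^sup>2"
  have "\<bar>measure_pmf.expectation (start_chain p (min n) t a) f - measure_pmf.expectation (start_chain p (\<lambda>z. z) t a) f\<bar>
     \<le> measure_pmf.expectation geo ?B"
    unfolding start_chain_def
  proof (rule expectation_bind_diff_le[of f, OF f])
    show "integrable (measure_pmf geo) ?B"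
      by (intro integrable_divide_zero geo_quadratic impI)
    show "\<bar>measure_pmf.expectation (chain p (min n) t (min n (a + int k))) f
          - measure_pmf.expectation (chain p (\<lambda>z. z) t (a + int k)) f\<bar> \<le> ?B k" for k
      using chain_barrier_error[of f, OF f an, of t "a + int k"] by simp
  qed
  also have "\<dots> = (geo_var + step_var * t) / (real_of_int (n - a))\<^sup>2"
    using geo_quadratic[of "step_var * t"] by simp
  finally show ?thesis .
qed

end


section \<open>Comparisons, positive parts and tail bounds\<close>

text \<open>Independence enters only through iterated expectations. Domination by a sum of
  one-variable functions supplies integrability at both levels and a bound by one-particle
  moments.\<close>

lemma iterated_expectation_bound:
  fixes f :: "'a \<Rightarrow> 'b \<Rightarrow> real"
  assumes g: "integrable (measure_pmf M) g" and h: "integrable (measure_pmf N) h"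
    and le: "\<And>u v. \<bar>f u v\<bar> \<le> c + g u + h v"
  shows "integrable (measure_pmf N) (f u)"
    and "integrable (measure_pmf M) (\<lambda>u. measure_pmf.expectation N (f u))"
    and "\<bar>measure_pmf.expectation M (\<lambda>u. measure_pmf.expectation N (f u))\<bar>
      \<le> c + measure_pmf.expectation M g + measure_pmf.expectation N h"
proof -
  have 1: "integrable (measure_pmf N) (f u)" for u
    by (rule Bochner_Integration.integrable_bound[where f="\<lambda>v. c + g u + h v"])
       (use h order_trans[OF le abs_ge_self] in \<open>auto intro!: Bochner_Integration.integrable_add\<close>)
  have 2: "\<bar>measure_pmf.expectation N (f u)\<bar> \<le> c + measure_pmf.expectation N h + g u" for u
  proof -
    have "\<bar>measure_pmf.expectation N (f u)\<bar> \<le> measure_pmf.expectation N (\<lambda>v. \<bar>f u v\<bar>)"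
      by (rule integral_abs_bound)
    also have "\<dots> \<le> measure_pmf.expectation N (\<lambda>v. c + g u + h v)"
      using 1 h le by (intro integral_mono) auto
    also have "\<dots> = c + measure_pmf.expectation N h + g u"
      using h by simp
    finally show ?thesis .
  qed
  show 3: "integrable (measure_pmf M) (\<lambda>u. measure_pmf.expectation N (f u))"
    by (rule Bochner_Integration.integrable_bound[where f="\<lambda>u. c + measure_pmf.expectation N h + g u"])
       (use g order_trans[OF 2 abs_ge_self] in \<open>auto intro!: Bochner_Integration.integrable_add\<close>)
  show "integrable (measure_pmf N) (f u)" by (rule 1)
  have "\<bar>measure_pmf.expectation M (\<lambda>u. measure_pmf.expectation N (f u))\<bar>
      \<le> measure_pmf.expectation M (\<lambda>u. \<bar>measure_pmf.expectation N (f u)\<bar>)"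
    by (rule integral_abs_bound)
  also have "\<dots> \<le> measure_pmf.expectation M (\<lambda>u. c + measure_pmf.expectation N h + g u)"
    using 2 3 g by (intro integral_mono) auto
  also have "\<dots> = c + measure_pmf.expectation M g + measure_pmf.expectation N h"
    using g by simp
  finally show "\<bar>measure_pmf.expectation M (\<lambda>u. measure_pmf.expectation N (f u))\<bar>
      \<le> c + measure_pmf.expectation M g + measure_pmf.expectation N h" .
qed

lemma tie_gt_shift: "tie_gt (u :: int) (v + d) = tie_gt (u - v) d"
  by (auto simp: tie_gt_def)

lemma tie_gt_of_nat: "tie_gt (int u) (int v) = tie_gt u v"
  by (auto simp: tie_gt_def)

lemma sum_tie_gt:
  "(\<Sum>d=1..L. tie_gt w (int d)) =
     (if w \<le> 0 then 0 else if w \<le> int L then real_of_int w - 1 / 2 else real L)"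
proof (induction L)
  case (Suc L)
  have "(\<Sum>d=1..Suc L. tie_gt w (int d)) = (\<Sum>d=1..L. tie_gt w (int d)) + tie_gt w (int (Suc L))"
    by simp
  then show ?case unfolding Suc by (auto simp: tie_gt_def)
qed auto

lemma square_diff_le: "(s - t)\<^sup>2 \<le> 2 * s\<^sup>2 + 2 * t\<^sup>2" for s t :: real
  using zero_le_power2[of "s + t"] unfolding power2_sum power2_diff by linarith

text \<open>Summing the comparison over all gaps counts the positive part of u - v, which is how the
  number of inversions in a row turns into a mean of positive parts. The 1/2 comes from the tie;
  stopping at \<open>L\<close> loses at most w, and only when w > L, where w is at most its square
  over L.\<close>

lemma sum_tie_gt_approx:
  assumes "0 < L"
  shows "\<bar>(\<Sum>d=1..L. tie_gt u (v + int d)) - max (real_of_int (u - v)) 0\<bar>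
    \<le> 1 / 2 + 2 * (real_of_int u)\<^sup>2 / L + 2 * (real_of_int v)\<^sup>2 / L"
proof -
  define w where "w = u - v"
  have "\<bar>(\<Sum>d=1..L. tie_gt w (int d)) - max (real_of_int w) 0\<bar> \<le> 1 / 2 + (real_of_int w)\<^sup>2 / L"
  proof (cases "w \<le> int L")
    case False
    then have "real_of_int w * L \<le> real_of_int w * w" by (intro mult_left_mono) auto
    then have "real_of_int w \<le> (real_of_int w)\<^sup>2 / L"
      using assms by (simp add: field_simps power2_eq_square)
    then show ?thesis using False unfolding sum_tie_gt by simp
  qed (auto simp: sum_tie_gt simp del: One_nat_def)
  also have "(real_of_int w)\<^sup>2 / L \<le> (2 * (real_of_int u)\<^sup>2 + 2 * (real_of_int v)\<^sup>2) / L"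
    using square_diff_le[of "real_of_int u" "real_of_int v"]
    by (intro divide_right_mono) (simp_all add: w_def)
  finally show ?thesis by (simp add: tie_gt_shift w_def add_divide_distrib)
qed

text \<open>Pointwise Chebyshev: if \<open>u\<close> has caught up with \<open>v\<close>, the two
  displacements together cover the initial gap \<open>y - x\<close>.\<close>

lemma tie_gt_quadratic_bound:
  fixes u v x y :: int
  assumes "x < y"
  shows "tie_gt u v \<le> 2 * (real_of_int (u - x))\<^sup>2 / (real_of_int (y - x))\<^sup>2
    + 2 * (real_of_int (v - y))\<^sup>2 / (real_of_int (y - x))\<^sup>2"
proof (cases "v \<le> u")
  case True
  have "(real_of_int (y - x))\<^sup>2 \<le> (real_of_int (u - x) - real_of_int (v - y))\<^sup>2"
    using assms True by (intro power_mono) auto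
  also have "\<dots> \<le> 2 * (real_of_int (u - x))\<^sup>2 + 2 * (real_of_int (v - y))\<^sup>2"
    by (rule square_diff_le)
  finally have "1 \<le> (2 * (real_of_int (u - x))\<^sup>2 + 2 * (real_of_int (v - y))\<^sup>2) / (real_of_int (y - x))\<^sup>2"
    using assms by simp
  then show ?thesis using tie_gt_bounds(2)[of u v] by (simp add: add_divide_distrib)
next
  case False
  then have "tie_gt u v = 0" by (simp add: tie_gt_def)
  then show ?thesis by simp
qed

text \<open>Comparison with the telescoping terms 1 / (b * (b + 1)).\<close>

lemma sum_inverse_squares_le:
  assumes "0 < L"
  shows "(\<Sum>d\<in>{L<..b}. 1 / (real d)\<^sup>2) \<le> 1 / L"
proof -
  have "(\<Sum>d\<in>{L<..b}. 1 / (real d)\<^sup>2) \<le> 1 / L - 1 / b" if "L \<le> b" for b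
    using that
  proof (induction b rule: dec_induct)
    case (step b)
    have "(\<Sum>d\<in>{L<..Suc b}. 1 / (real d)\<^sup>2) = (\<Sum>d\<in>{L<..b}. 1 / (real d)\<^sup>2) + 1 / (real (Suc b))\<^sup>2"
    proof -
      have "{L<..Suc b} = insert (Suc b) {L<..b}" using step by auto
      then show ?thesis by simp
    qed
    also have "1 / (real (Suc b))\<^sup>2 \<le> 1 / b - 1 / Suc b"
    proof -
      have "1 / (real (Suc b))\<^sup>2 \<le> 1 / (real b * real (Suc b))"
        using step assms by (intro divide_left_mono) (auto simp: power2_eq_square)
      also have "\<dots> = 1 / b - 1 / Suc b" using step assms by (simp add: field_simps)
      finally show ?thesis .
    qed
    finally show ?case using step by simp
  qed simp
  from this[of b] show ?thesis
    by (cases "L \<le> b") (auto intro: order_trans)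
qed

section \<open>Inversions within one row\<close>

context keep_probability
begin

lemma chain_shift: "chain p (\<lambda>z. z) t (x + y) = map_pmf (\<lambda>z. z + y) (chain p (\<lambda>z. z) t x)"
proof (induction t arbitrary: x)
  case (Suc t)
  have "x + y + k = x + k + y" for k by simp
  then show ?case by (simp only: chain.simps map_bind_pmf Suc)
qed simp

lemma start_chain_shift:
  "start_chain p (\<lambda>z. z) t (x + y) = map_pmf (\<lambda>z. z + y) (start_chain p (\<lambda>z. z) t x)"
proof -
  have "x + y + k = x + k + y" for k by simp
  then show ?thesis by (simp only: start_chain_def map_bind_pmf chain_shift)
qed

text \<open>The exponent is \<open>a - 1\<close> because the geometric start already accounts for
  row \<open>a\<close>; the other particle makes \<open>a\<close> ordinary steps.\<close>

definition free_X :: "nat \<Rightarrow> int pmf" where "free_X a = start_chain p (\<lambda>z. z) (a - 1) 0"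
definition free_Y :: "nat \<Rightarrow> int pmf" where "free_Y a = chain p (\<lambda>z. z) a 0"
definition mean_pos :: "nat \<Rightarrow> real" where
  "mean_pos a = measure_pmf.expectation (free_X a)
     (\<lambda>u. measure_pmf.expectation (free_Y a) (\<lambda>v. max (real_of_int (u - v)) 0))"

text \<open>Chosen so that \<open>var_bound * n\<close> bounds the summed second moments of both
  walks for every row \<open>a \<le> n\<close>; for n > 0 the constant \<open>geo_var\<close> is
  absorbed into the multiple of n.\<close>

definition var_bound :: real where "var_bound = geo_var + 2 * step_var"

lemma var_bound_ge:
  assumes "0 < n" "a \<le> n"
  shows "geo_var + 2 * step_var * real a \<le> var_bound * n"
proof -
  have "geo_var * 1 \<le> geo_var * real n" using assms geo_var_nonneg by (intro mult_left_mono) auto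
  moreover have "2 * step_var * real a \<le> 2 * step_var * real n"
    using assms step_var_nonneg by (intro mult_left_mono) auto
  ultimately show ?thesis by (simp add: var_bound_def algebra_simps)
qed

lemma var_bound_nonneg: "0 \<le> var_bound"
  using geo_var_nonneg step_var_nonneg by (simp add: var_bound_def)

lemma free_second_moments:
  "integrable (measure_pmf (free_X a)) (\<lambda>u. (real_of_int u)\<^sup>2)"
  "integrable (measure_pmf (free_Y a)) (\<lambda>u. (real_of_int u)\<^sup>2)"
  "measure_pmf.expectation (free_X a) (\<lambda>u. (real_of_int u)\<^sup>2)
    + measure_pmf.expectation (free_Y a) (\<lambda>u. (real_of_int u)\<^sup>2) \<le> geo_var + 2 * step_var * a"
proof -
  show "integrable (measure_pmf (free_X a)) (\<lambda>u. (real_of_int u)\<^sup>2)"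
    using start_chain_second_moment(1)[of "\<lambda>z. z" 0 "a - 1"] by (simp add: free_X_def)
  show "integrable (measure_pmf (free_Y a)) (\<lambda>u. (real_of_int u)\<^sup>2)"
    using chain_second_moment(1)[of "\<lambda>z. z" 0 a 0] by (simp add: free_Y_def)
  have "step_var * real (a - 1) \<le> step_var * a" using step_var_nonneg by (intro mult_left_mono) auto
  then have "measure_pmf.expectation (free_X a) (\<lambda>u. (real_of_int u)\<^sup>2) \<le> geo_var + step_var * a"
    using start_chain_second_moment(2)[of "\<lambda>z. z" 0 "a - 1"] by (simp add: free_X_def)
  moreover have "measure_pmf.expectation (free_Y a) (\<lambda>u. (real_of_int u)\<^sup>2) \<le> step_var * a"
    using chain_second_moment(2)[of "\<lambda>z. z" 0 a 0] by (simp add: free_Y_def)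
  ultimately show "measure_pmf.expectation (free_X a) (\<lambda>u. (real_of_int u)\<^sup>2)
    + measure_pmf.expectation (free_Y a) (\<lambda>u. (real_of_int u)\<^sup>2) \<le> geo_var + 2 * step_var * a"
    by simp
qed

definition inv_prob :: "nat \<Rightarrow> nat \<Rightarrow> nat \<Rightarrow> real" where
  "inv_prob n a y = measure_pmf.expectation (pos_pmf p (rows n a) a)
       (\<lambda>u. measure_pmf.expectation (pos_pmf p (rows n a) y) (tie_gt u))"

lemma inv_prob_eq:
  assumes "0 < a" "a < y" "y \<le> n"
  shows "inv_prob n a y = measure_pmf.expectation (start_chain p (min (int n)) (a - 1) (int a))
       (\<lambda>u. measure_pmf.expectation (chain p (min (int n)) a (int y)) (tie_gt u))"
proof -
  have "start_chain p (min (int n)) (a - 1) (int a) = map_pmf int (pos_pmf p (rows n a) a)"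
    using assms by (intro map_int_pos_pmf_rows_start[symmetric]) auto
  moreover have "chain p (min (int n)) a (int y) = map_pmf int (pos_pmf p (rows n a) y)"
    using assms by (intro map_int_pos_pmf_rows[symmetric]) auto
  ultimately show ?thesis by (simp only: inv_prob_def integral_map_pmf tie_gt_of_nat)
qed

text \<open>Chebyshev for the walks with the barrier still in place. No barrier error arises, so the
  bound holds up to the edge \<open>a + d = n\<close> and is summable in \<open>d\<close>.\<close>

lemma inv_prob_far:
  assumes a: "0 < a" and d: "0 < d" "a + d \<le> n"
  shows "inv_prob n a (a + d) \<le> 2 * var_bound * n / (real d)\<^sup>2"
proof -
  let ?M = "start_chain p (min (int n)) (a - 1) (int a)"
  let ?N = "chain p (min (int n)) a (int (a + d))"
  let ?g = "\<lambda>u. 2 * (real_of_int (u - int a))\<^sup>2 / (real d)\<^sup>2"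
  let ?h = "\<lambda>v. 2 * (real_of_int (v - int (a + d)))\<^sup>2 / (real d)\<^sup>2"
  have phi: "\<bar>min (int n) z - c\<bar> \<le> \<bar>z - c\<bar>" if "c \<le> int n" for z c
    using that by (auto simp: min_def)
  have 1: "integrable (measure_pmf ?M) (\<lambda>z. (real_of_int (z - int a))\<^sup>2)"
    and 2: "measure_pmf.expectation ?M (\<lambda>z. (real_of_int (z - int a))\<^sup>2) \<le> geo_var + step_var * real (a - 1)"
    using phi[of "int a"] d by (intro start_chain_second_moment; simp)+
  have 3: "integrable (measure_pmf ?N) (\<lambda>z. (real_of_int (z - int (a + d)))\<^sup>2)"
    and 4: "measure_pmf.expectation ?N (\<lambda>z. (real_of_int (z - int (a + d)))\<^sup>2) \<le> step_var * a"
    using chain_second_moment[of "min (int n)" "int (a + d)" a "int (a + d)"] phi[of "int (a + d)"] d by auto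
  have le: "\<bar>tie_gt u v\<bar> \<le> 0 + ?g u + ?h v" for u v
    using tie_gt_quadratic_bound[of "int a" "int (a + d)" u v] tie_gt_bounds(1)[of u v] d by simp
  have "inv_prob n a (a + d) \<le> 0 + measure_pmf.expectation ?M ?g + measure_pmf.expectation ?N ?h"
    using iterated_expectation_bound(3)[of ?M ?g ?N ?h tie_gt 0, OF _ _ le] 1 3 a d by (subst inv_prob_eq) auto
  also have "\<dots> = 2 * (measure_pmf.expectation ?M (\<lambda>z. (real_of_int (z - int a))\<^sup>2)
      + measure_pmf.expectation ?N (\<lambda>z. (real_of_int (z - int (a + d)))\<^sup>2)) / (real d)\<^sup>2"
    by (simp add: add_divide_distrib)
  also have "\<dots> \<le> 2 * (var_bound * n) / (real d)\<^sup>2"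
  proof (intro divide_right_mono mult_left_mono)
    have "step_var * real (a - 1) \<le> step_var * a" using step_var_nonneg by (intro mult_left_mono) auto
    then show "measure_pmf.expectation ?M (\<lambda>z. (real_of_int (z - int a))\<^sup>2)
      + measure_pmf.expectation ?N (\<lambda>z. (real_of_int (z - int (a + d)))\<^sup>2) \<le> var_bound * n"
      using 2 4 var_bound_ge[of n a] d by simp
  qed auto
  finally show ?thesis by simp
qed

text \<open>The barrier is removed from one particle at a time, first from the one started at
  \<open>a + d\<close>. Each replacement changes the expectation of a function with values in
  [0, 1]; afterwards both walks are shifted to the origin.\<close>

lemma inv_prob_near:
  assumes a: "0 < a" and d: "0 < d" "a + d \<le> n"
  shows "\<bar>inv_prob n a (a + d) - measure_pmf.expectation (free_X a)
       (\<lambda>u. measure_pmf.expectation (free_Y a) (\<lambda>v. tie_gt u (v + int d)))\<bar>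
    \<le> ((real d)\<^sup>2 + var_bound * n) / (real (n - a))\<^sup>2"
proof -
  let ?m = "min (int n)" and ?i = "\<lambda>z::int. z"
  let ?M = "start_chain p ?m (a - 1) (int a)" and ?M' = "start_chain p ?i (a - 1) (int a)"
  let ?N = "chain p ?m a (int (a + d))" and ?N' = "chain p ?i a (int (a + d))"
  have an: "int a < int n" using d by simp
  have b: "0 \<le> tie_gt u v" "tie_gt u v \<le> 1" for u v :: int by (rule tie_gt_bounds)+
  have "\<bar>measure_pmf.expectation ?M (\<lambda>u. measure_pmf.expectation ?N (tie_gt u) - measure_pmf.expectation ?N' (tie_gt u))\<bar>
    \<le> ((real d)\<^sup>2 + step_var * a) / (real (n - a))\<^sup>2"
  proof -
    have "norm (measure_pmf.expectation ?M (\<lambda>u. measure_pmf.expectation ?N (tie_gt u) - measure_pmf.expectation ?N' (tie_gt u)))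
      \<le> ((real d)\<^sup>2 + step_var * a) / (real (n - a))\<^sup>2"
    proof (rule norm_expectation_le)
      fix u :: int
      \<comment> \<open>Distances are measured from \<open>a\<close> even for the particle started
        at \<open>a + d\<close>: measured from \<open>a + d\<close>, the denominator would vanish at
        \<open>d = n - a\<close>. The price is the summand with the square of
        \<open>d\<close>.\<close>
      have "int (a + d) = min (int n) (int (a + d))" using d by simp
      then show "norm (measure_pmf.expectation ?N (tie_gt u) - measure_pmf.expectation ?N' (tie_gt u))
        \<le> ((real d)\<^sup>2 + step_var * a) / (real (n - a))\<^sup>2"
        using chain_barrier_error[of "tie_gt u" "int a" "int n" a "int (a + d)", OF b an] an by (simp add: of_nat_diff)
    qed
    then show ?thesis by simp
  qed
  moreover have "measure_pmf.expectation ?M (\<lambda>u. measure_pmf.expectation ?N (tie_gt u) - measure_pmf.expectation ?N' (tie_gt u))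
     = inv_prob n a (a + d) - measure_pmf.expectation ?M (\<lambda>u. measure_pmf.expectation ?N' (tie_gt u))"
    using a d expectation_unit_interval[of "tie_gt u" for u, OF b]
    by (subst inv_prob_eq) (auto intro!: Bochner_Integration.integral_diff integrable_measure_pmf_bounded[where B=1])
  moreover have "\<bar>measure_pmf.expectation ?M (\<lambda>u. measure_pmf.expectation ?N' (tie_gt u))
      - measure_pmf.expectation ?M' (\<lambda>u. measure_pmf.expectation ?N' (tie_gt u))\<bar>
      \<le> (geo_var + step_var * real (a - 1)) / (real (n - a))\<^sup>2"
    using start_chain_barrier_error[of "\<lambda>u. measure_pmf.expectation ?N' (tie_gt u)" "int a" "int n" "a - 1"]
      expectation_unit_interval[of "tie_gt u" for u, OF b] an by (simp add: of_nat_diff)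
  moreover have "measure_pmf.expectation ?M' (\<lambda>u. measure_pmf.expectation ?N' (tie_gt u)) =
     measure_pmf.expectation (free_X a) (\<lambda>u. measure_pmf.expectation (free_Y a) (\<lambda>v. tie_gt u (v + int d)))"
  proof -
    have t: "tie_gt (u + int a) (v + int (a + d)) = tie_gt u (v + int d)" for u v
      by (auto simp: tie_gt_def)
    show ?thesis
      using start_chain_shift[of "a - 1" 0 "int a"] chain_shift[of a 0 "int (a + d)"]
      by (simp only: free_X_def free_Y_def integral_map_pmf t add_0)
  qed
  moreover have "((real d)\<^sup>2 + step_var * a) / (real (n - a))\<^sup>2 + (geo_var + step_var * real (a - 1)) / (real (n - a))\<^sup>2
     \<le> ((real d)\<^sup>2 + var_bound * n) / (real (n - a))\<^sup>2"
  proof -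
    have "step_var * real (a - 1) \<le> step_var * a" using step_var_nonneg by (intro mult_left_mono) auto
    then have "((real d)\<^sup>2 + step_var * a) + (geo_var + step_var * real (a - 1)) \<le> (real d)\<^sup>2 + var_bound * n"
      using var_bound_ge[of n a] d by simp
    then show ?thesis unfolding add_divide_distrib[symmetric] by (rule divide_right_mono) simp
  qed
  ultimately show ?thesis by linarith
qed

lemma free_sum_approx:
  assumes "0 < L" "0 < n" "a \<le> n"
  shows "\<bar>(\<Sum>d=1..L. measure_pmf.expectation (free_X a)
       (\<lambda>u. measure_pmf.expectation (free_Y a) (\<lambda>v. tie_gt u (v + int d)))) - mean_pos a\<bar>
    \<le> 1 / 2 + 2 * var_bound * n / L"
proof -
  let ?X = "free_X a" and ?Y = "free_Y a"
  let ?f = "\<lambda>u v. (\<Sum>d=1..L. tie_gt u (v + int d)) - max (real_of_int (u - v)) 0"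
  let ?q = "\<lambda>u. 2 * (real_of_int u)\<^sup>2 / L"
  note m = free_second_moments[of a]
  have q: "integrable (measure_pmf ?X) ?q" "integrable (measure_pmf ?Y) ?q" using m by auto
  have t1: "integrable (measure_pmf M) (\<lambda>v. tie_gt u (v + int d))" for u M d
    by (rule integrable_measure_pmf_bounded[where B=1]) (simp add: abs_tie_gt_le)
  have t2: "integrable (measure_pmf M) (\<lambda>u. measure_pmf.expectation M' (\<lambda>v. tie_gt u (v + int d)))" for M M' d
    by (intro integrable_measure_pmf_bounded[where B=1] norm_expectation_le) (simp add: abs_tie_gt_le)
  have le: "\<bar>max (real_of_int (u - v)) 0\<bar> \<le> 0 + (real_of_int u)\<^sup>2 + (real_of_int v)\<^sup>2" for u v
  proof -
    have "\<bar>z\<bar> \<le> z\<^sup>2" for z :: int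
      using self_le_power[of "\<bar>z\<bar>" 2] by (cases "z = 0") auto
    then have "real_of_int \<bar>z\<bar> \<le> real_of_int (z\<^sup>2)" for z :: int
      by (simp only: of_int_le_iff)
    from this[of u] this[of v] show ?thesis by simp
  qed
  note mx = iterated_expectation_bound[OF m(1,2) le]
  have "measure_pmf.expectation ?X (\<lambda>u. measure_pmf.expectation ?Y (?f u))
     = measure_pmf.expectation ?X (\<lambda>u. (\<Sum>d=1..L. measure_pmf.expectation ?Y (\<lambda>v. tie_gt u (v + int d)))
        - measure_pmf.expectation ?Y (\<lambda>v. max (real_of_int (u - v)) 0))"
    using mx(1) t1 by (simp add: Bochner_Integration.integral_sum Bochner_Integration.integral_diff)
  also have "\<dots> = (\<Sum>d=1..L. measure_pmf.expectation ?X
       (\<lambda>u. measure_pmf.expectation ?Y (\<lambda>v. tie_gt u (v + int d)))) - mean_pos a"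
    using mx(2) t2 by (simp add: Bochner_Integration.integral_sum Bochner_Integration.integral_diff mean_pos_def)
  finally have "\<bar>(\<Sum>d=1..L. measure_pmf.expectation ?X
       (\<lambda>u. measure_pmf.expectation ?Y (\<lambda>v. tie_gt u (v + int d)))) - mean_pos a\<bar>
     \<le> 1 / 2 + measure_pmf.expectation ?X ?q + measure_pmf.expectation ?Y ?q"
    using iterated_expectation_bound(3)[OF q sum_tie_gt_approx[OF assms(1)]] by simp
  also have "\<dots> = 1 / 2 + 2 * (measure_pmf.expectation ?X (\<lambda>u. (real_of_int u)\<^sup>2)
       + measure_pmf.expectation ?Y (\<lambda>u. (real_of_int u)\<^sup>2)) / L"
    by (simp add: add_divide_distrib)
  also have "\<dots> \<le> 1 / 2 + 2 * (var_bound * n) / L"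
    using m(3) var_bound_ge[of n a] assms by (intro add_left_mono divide_right_mono mult_left_mono) auto
  finally show ?thesis by simp
qed

text \<open>Gaps up to \<open>L\<close> cost one barrier error each. The tail beyond
  \<open>L\<close> costs 2 * var_bound * n / L twice, once in the true sum and once in the free sum,
  hence the 4; the 1/2 is the tie error.\<close>

lemma row_approx:
  assumes a: "0 < a" "a < n" and L: "0 < L" "L \<le> n - a"
  shows "\<bar>(\<Sum>y\<in>{a<..n}. inv_prob n a y) - mean_pos a\<bar>
    \<le> real L * ((real L)\<^sup>2 + var_bound * n) / (real (n - a))\<^sup>2 + 4 * (var_bound * n) / L + 1 / 2"
proof -
  let ?F = "\<lambda>d. measure_pmf.expectation (free_X a) (\<lambda>u. measure_pmf.expectation (free_Y a) (\<lambda>v. tie_gt u (v + int d)))"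
  have "(\<Sum>y\<in>{a<..n}. inv_prob n a y) = (\<Sum>d\<in>{1..n - a}. inv_prob n a (a + d))"
    by (rule sum.reindex_bij_witness[of _ "\<lambda>d. a + d" "\<lambda>y. y - a"]) (use a in auto)
  also have "{1..n - a} = {1..L} \<union> {L<..n - a}" using L by auto
  also have "(\<Sum>d\<in>\<dots>. inv_prob n a (a + d)) = (\<Sum>d=1..L. inv_prob n a (a + d)) + (\<Sum>d\<in>{L<..n - a}. inv_prob n a (a + d))"
    by (rule sum.union_disjoint) auto
  finally have split: "(\<Sum>y\<in>{a<..n}. inv_prob n a y) =
     (\<Sum>d=1..L. inv_prob n a (a + d)) + (\<Sum>d\<in>{L<..n - a}. inv_prob n a (a + d))" .
  have "\<bar>(\<Sum>d=1..L. inv_prob n a (a + d)) - (\<Sum>d=1..L. ?F d)\<bar> \<le> (\<Sum>d=1..L. \<bar>inv_prob n a (a + d) - ?F d\<bar>)"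
    unfolding sum_subtractf[symmetric] by (rule sum_abs)
  also have "\<dots> \<le> (\<Sum>d=1..L. ((real L)\<^sup>2 + var_bound * n) / (real (n - a))\<^sup>2)"
  proof (rule sum_mono)
    fix d assume d: "d \<in> {1..L}"
    have "\<bar>inv_prob n a (a + d) - ?F d\<bar> \<le> ((real d)\<^sup>2 + var_bound * n) / (real (n - a))\<^sup>2"
      using a L d by (intro inv_prob_near) auto
    also have "\<dots> \<le> ((real L)\<^sup>2 + var_bound * n) / (real (n - a))\<^sup>2"
      using d by (intro divide_right_mono add_right_mono power_mono) auto
    finally show "\<bar>inv_prob n a (a + d) - ?F d\<bar> \<le> ((real L)\<^sup>2 + var_bound * n) / (real (n - a))\<^sup>2" .
  qed
  also have "\<dots> = real L * ((real L)\<^sup>2 + var_bound * n) / (real (n - a))\<^sup>2"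
    by simp
  finally have near: "\<bar>(\<Sum>d=1..L. inv_prob n a (a + d)) - (\<Sum>d=1..L. ?F d)\<bar>
     \<le> real L * ((real L)\<^sup>2 + var_bound * n) / (real (n - a))\<^sup>2" .
  have "(\<Sum>d\<in>{L<..n - a}. inv_prob n a (a + d)) \<le> (\<Sum>d\<in>{L<..n - a}. 2 * var_bound * n * (1 / (real d)\<^sup>2))"
  proof (rule sum_mono)
    fix d assume "d \<in> {L<..n - a}"
    then show "inv_prob n a (a + d) \<le> 2 * var_bound * n * (1 / (real d)\<^sup>2)"
      using inv_prob_far[of a d n] a by auto
  qed
  also have "\<dots> = 2 * var_bound * n * (\<Sum>d\<in>{L<..n - a}. 1 / (real d)\<^sup>2)"
    by (rule sum_distrib_left[symmetric])
  also have "\<dots> \<le> 2 * var_bound * n * (1 / L)"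
    using var_bound_nonneg L by (intro mult_left_mono sum_inverse_squares_le) auto
  finally have far: "(\<Sum>d\<in>{L<..n - a}. inv_prob n a (a + d)) \<le> 2 * (var_bound * n) / L" by simp
  have "0 \<le> inv_prob n a y" for y
    unfolding inv_prob_def by (intro integral_nonneg_AE AE_I2 tie_gt_bounds)
  then have "0 \<le> (\<Sum>d\<in>{L<..n - a}. inv_prob n a (a + d))" by (intro sum_nonneg)
  moreover have "\<bar>(\<Sum>d=1..L. ?F d) - mean_pos a\<bar> \<le> 1 / 2 + 2 * (var_bound * n) / L"
    using free_sum_approx[of L n a] a L by (simp add: mult.assoc)
  moreover have "4 * (var_bound * n) / L = 2 * (var_bound * n) / L + 2 * (var_bound * n) / L" by simp
  ultimately show ?thesis using near far unfolding split by linarith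
qed

section \<open>Summing the errors over the rows\<close>

text \<open>Integral comparison for b powr (- 2/3) in discrete form, so that the row errors
  telescope.\<close>

lemma root3_increment:
  assumes "0 < b"
  shows "1 / (root 3 (real b))\<^sup>2 \<le> 3 * (root 3 (real b) - root 3 (real (b - 1)))"
proof -
  define x y where "x = root 3 (real b)" and "y = root 3 (real (b - 1))"
  have x: "x ^ 3 = real b" "0 < x" using assms by (simp_all add: x_def)
  have y: "y ^ 3 = real (b - 1)" "0 \<le> y" by (simp_all add: y_def)
  have yx: "y \<le> x" by (simp add: x_def y_def)
  have "1 = x ^ 3 - y ^ 3" using x y assms by (simp add: of_nat_diff)
  also have "\<dots> = (x - y) * (x * x + x * y + y * y)" by (simp add: power3_eq_cube algebra_simps)
  also have "\<dots> \<le> (x - y) * (x * x + x * x + x * x)"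
    using x y yx by (intro mult_left_mono add_mono mult_mono) auto
  finally have "1 \<le> 3 * (x - y) * x\<^sup>2" by (simp add: power2_eq_square algebra_simps)
  then have "1 / x\<^sup>2 \<le> 3 * (x - y)" using x by (subst divide_le_eq) auto
  then show ?thesis by (simp only: x_def y_def)
qed

text \<open>The choice \<open>L \<approx> (n - a) powr (2 / 3)\<close> makes the boundary term bounded while the tail
  remains summable to \<open>o(n powr (3 / 2))\<close>.\<close>

lemma row_approx_root:
  assumes a: "0 < a" "a < n"
  shows "\<bar>(\<Sum>y\<in>{a<..n}. inv_prob n a y) - mean_pos a\<bar>
    \<le> 3 / 2 + 9 * (var_bound * n) * (1 / (root 3 (real (n - a)))\<^sup>2)"
proof -
  define b x where "b = n - a" and "x = root 3 (real b)"
  define L where "L = nat \<lfloor>x\<^sup>2\<rfloor>"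
  have b: "0 < b" using a by (simp add: b_def)
  have x3: "x ^ 3 = real b" and x1: "1 \<le> x" using b by (simp_all add: x_def)
  have xx: "1 \<le> x\<^sup>2" using x1 by (simp add: one_le_power)
  have L0: "0 < L" using xx by (simp add: L_def)
  have Lx: "real L \<le> x\<^sup>2" using xx by (simp add: L_def)
  have xL: "x\<^sup>2 \<le> 2 * real L"
  proof -
    have "x\<^sup>2 < real L + 1" using xx unfolding L_def by linarith
    then show ?thesis using L0 by linarith
  qed
  have "x\<^sup>2 \<le> x ^ 3" using x1 by (intro power_increasing) auto
  then have Lb: "L \<le> n - a" using Lx x3 by (simp add: b_def[symmetric])
  have vn: "0 \<le> var_bound * real n" using var_bound_nonneg by simp
  have bx: "(real b)\<^sup>2 = x\<^sup>2 * x\<^sup>2 * x\<^sup>2" by (simp add: x3[symmetric] power_mult_distrib power2_eq_square power3_eq_cube mult_ac)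
  have "real L * ((real L)\<^sup>2 + var_bound * n) / (real b)\<^sup>2 \<le> x\<^sup>2 * ((x\<^sup>2)\<^sup>2 + var_bound * n) / (real b)\<^sup>2"
    using Lx vn by (intro divide_right_mono mult_mono add_right_mono power_mono) auto
  also have "\<dots> = 1 + var_bound * n * (1 / (x\<^sup>2 * x\<^sup>2))"
    using x1 unfolding bx by (simp add: field_simps power2_eq_square)
  also have "\<dots> \<le> 1 + var_bound * n * (1 / (x\<^sup>2 * 1))"
    using vn xx x1 by (intro add_left_mono mult_left_mono divide_left_mono) auto
  finally have 1: "real L * ((real L)\<^sup>2 + var_bound * n) / (real b)\<^sup>2 \<le> 1 + var_bound * n * (1 / x\<^sup>2)" by simp
  have "4 * (var_bound * n) / L \<le> 4 * (var_bound * n) / (x\<^sup>2 / 2)"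
    using vn xL L0 x1 by (intro divide_left_mono mult_pos_pos) auto
  then have 2: "4 * (var_bound * n) / L \<le> 8 * (var_bound * n) * (1 / x\<^sup>2)" by simp
  \<comment> \<open>Here 3/2 is the boundary term 1 plus the tie error 1/2, and 9 is 1 from the
    barrier error plus 8 from the tail, which doubled through
    \<open>x\<^sup>2 \<le> 2 * real L\<close>.\<close>
  show ?thesis
    using row_approx[OF a L0 Lb] 1 2 unfolding b_def[symmetric] x_def[symmetric] by simp
qed

text \<open>The error has order n powr (4/3), below the main order n powr (3/2). The factor 27 is 9
  times the 3 of \<open>root3_increment\<close>.\<close>

lemma expectation_inversions_approx:
  "\<bar>measure_pmf.expectation (random_perm p n) (\<lambda>v. real (inversions n v)) - (\<Sum>a\<in>{1..<n}. mean_pos a)\<bar>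
    \<le> 3 / 2 * n + 27 * (var_bound * n) * root 3 n"
proof -
  have "measure_pmf.expectation (random_perm p n) (\<lambda>v. real (inversions n v))
     = (\<Sum>a\<in>{1..<n}. \<Sum>y\<in>{a<..n}. inv_prob n a y)"
    using p0 p1 by (simp add: expectation_inversions inv_prob_def)
  then have "\<bar>measure_pmf.expectation (random_perm p n) (\<lambda>v. real (inversions n v)) - (\<Sum>a\<in>{1..<n}. mean_pos a)\<bar>
    \<le> (\<Sum>a\<in>{1..<n}. \<bar>(\<Sum>y\<in>{a<..n}. inv_prob n a y) - mean_pos a\<bar>)"
    by (simp only: sum_subtractf[symmetric] sum_abs)
  also have "\<dots> \<le> (\<Sum>a\<in>{1..<n}. 3 / 2 + 9 * (var_bound * n) * (3 * (root 3 (real (n - a)) - root 3 (real (n - a - 1)))))"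
  proof (rule sum_mono)
    fix a assume a: "a \<in> {1..<n}"
    have "\<bar>(\<Sum>y\<in>{a<..n}. inv_prob n a y) - mean_pos a\<bar>
      \<le> 3 / 2 + 9 * (var_bound * n) * (1 / (root 3 (real (n - a)))\<^sup>2)"
      using a by (intro row_approx_root) auto
    also have "\<dots> \<le> 3 / 2 + 9 * (var_bound * n) * (3 * (root 3 (real (n - a)) - root 3 (real (n - a - 1))))"
      using a var_bound_nonneg by (intro add_left_mono mult_left_mono root3_increment) auto
    finally show "\<bar>(\<Sum>y\<in>{a<..n}. inv_prob n a y) - mean_pos a\<bar>
      \<le> 3 / 2 + 9 * (var_bound * n) * (3 * (root 3 (real (n - a)) - root 3 (real (n - a - 1))))" .
  qed
  also have "\<dots> = 3 / 2 * real (n - 1) + 27 * (var_bound * n) * (\<Sum>a\<in>{1..<n}. root 3 (real (n - a)) - root 3 (real (n - a - 1)))"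
  proof -
    have "3 / 2 + 9 * (var_bound * n) * (3 * t) = 3 / 2 + 27 * (var_bound * n) * t" for t :: real by simp
    then show ?thesis
      by (simp only: sum.distrib sum_distrib_left) simp
  qed
  also have "(\<Sum>a\<in>{1..<n}. root 3 (real (n - a)) - root 3 (real (n - a - 1))) = root 3 (real (n - 1))"
  proof (cases "n = 0")
    case False
    have "(\<Sum>a\<in>{1..<n}. root 3 (real (n - a)) - root 3 (real (n - a - 1)))
       = (\<Sum>b<n - 1. root 3 (real (Suc b)) - root 3 (real b))"
      by (rule sum.reindex_bij_witness[of _ "\<lambda>b. n - Suc b" "\<lambda>a. n - Suc a"]) (auto simp: Suc_diff_Suc)
    also have "\<dots> = root 3 (real (n - 1)) - root 3 (real 0)" by (rule sum_lessThan_telescope)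
    finally show ?thesis by simp
  qed simp
  also have "3 / 2 * real (n - 1) + 27 * (var_bound * n) * root 3 (real (n - 1)) \<le> 3 / 2 * n + 27 * (var_bound * n) * root 3 n"
    using var_bound_nonneg by (intro add_mono mult_left_mono) auto
  finally show ?thesis .
qed

end


section \<open>Characteristic functions and the normal limit\<close>

lemma integral_bind_pmf_bounded_complex:
  fixes f :: "'b \<Rightarrow> complex"
  assumes "\<And>x. norm (f x) \<le> B"
  shows "measure_pmf.expectation (M \<bind> N) f = measure_pmf.expectation M (\<lambda>x. measure_pmf.expectation (N x) f)"
proof -
  have i: "integrable (measure_pmf M) f" for M
    using assms by (rule integrable_measure_pmf_bounded)
  have i': "integrable (measure_pmf M) (\<lambda>x. measure_pmf.expectation (N x) f)"
    using assms by (intro integrable_measure_pmf_bounded[where B=B] norm_expectation_le)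
  have re: "\<bar>Re (f x)\<bar> \<le> B" and im: "\<bar>Im (f x)\<bar> \<le> B" for x
    using abs_Re_le_cmod[of "f x"] abs_Im_le_cmod[of "f x"] assms[of x] by linarith+
  note R = integral_bounded_linear[OF bounded_linear_Re] and I = integral_bounded_linear[OF bounded_linear_Im]
  have "Re (measure_pmf.expectation (M \<bind> N) f) = measure_pmf.expectation (M \<bind> N) (\<lambda>x. Re (f x))"
    using R[OF i] by simp
  also have "\<dots> = measure_pmf.expectation M (\<lambda>x. measure_pmf.expectation (N x) (\<lambda>x. Re (f x)))"
    using re by (rule integral_bind_pmf_bounded)
  also have "\<dots> = Re (measure_pmf.expectation M (\<lambda>x. measure_pmf.expectation (N x) f))"
    using R[OF i] R[OF i'] by simp
  finally have 1: "Re (measure_pmf.expectation (M \<bind> N) f) = Re (measure_pmf.expectation M (\<lambda>x. measure_pmf.expectation (N x) f))" .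
  have "Im (measure_pmf.expectation (M \<bind> N) f) = measure_pmf.expectation (M \<bind> N) (\<lambda>x. Im (f x))"
    using I[OF i] by simp
  also have "\<dots> = measure_pmf.expectation M (\<lambda>x. measure_pmf.expectation (N x) (\<lambda>x. Im (f x)))"
    using im by (rule integral_bind_pmf_bounded)
  also have "\<dots> = Im (measure_pmf.expectation M (\<lambda>x. measure_pmf.expectation (N x) f))"
    using I[OF i] I[OF i'] by simp
  finally show ?thesis using 1 by (rule complex_eqI[rotated])
qed

text \<open>On the closed unit disc n-th powers differ by at most n times the distance of the bases.
  Comparing with 1 + c / n avoids complex logarithms; \<open>c \<le> 0\<close> puts this number into
  the disc once n is at least - c.\<close>

lemma tendsto_power_exp_limit:
  fixes z :: "nat \<Rightarrow> complex" and c :: real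
  assumes z: "\<And>n. norm (z n) \<le> 1" and lim: "(\<lambda>n. of_nat n * (z n - 1)) \<longlonglongrightarrow> of_real c" and c: "c \<le> 0"
  shows "(\<lambda>n. z n ^ n) \<longlonglongrightarrow> of_real (exp c)"
proof -
  have "(\<lambda>n. z n ^ n - of_real ((1 + c / real n) ^ n)) \<longlonglongrightarrow> 0"
  proof (rule Lim_null_comparison)
    have "(\<lambda>n. norm (of_nat n * (z n - 1) - of_real c)) \<longlonglongrightarrow> norm (of_real c - of_real c :: complex)"
      by (intro tendsto_norm tendsto_diff lim tendsto_const)
    then show "(\<lambda>n. norm (of_nat n * (z n - 1) - of_real c)) \<longlonglongrightarrow> 0" by simp
    show "\<forall>\<^sub>F n in sequentially. norm (z n ^ n - of_real ((1 + c / real n) ^ n)) \<le> norm (of_nat n * (z n - 1) - of_real c)"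
      using eventually_ge_at_top[of "max 1 (nat \<lceil>- c\<rceil>)"]
    proof eventually_elim
      case (elim n)
      have n: "0 < real n" "- c \<le> real n" using elim by (auto simp: nat_ceiling_le_eq)
      then have "- 1 \<le> c / real n" by (simp add: field_simps)
      moreover have "c / real n \<le> 0" using c n by (simp add: divide_nonpos_pos)
      ultimately have w: "norm (1 + of_real c / of_nat n :: complex) \<le> 1"
      proof -
        have "1 + of_real c / of_nat n = (of_real (1 + c / real n) :: complex)" by simp
        then show ?thesis using \<open>- 1 \<le> c / real n\<close> \<open>c / real n \<le> 0\<close> by (simp only: norm_of_real)
      qed
      have "norm (z n ^ n - of_real ((1 + c / real n) ^ n)) = norm (z n ^ n - (1 + of_real c / of_nat n) ^ n)"
        by simp
      also have "\<dots> \<le> n * norm (z n - (1 + of_real c / of_nat n))"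
        by (rule norm_power_diff[OF z w])
      also have "\<dots> = norm (of_nat n * (z n - (1 + of_real c / of_nat n)))"
        by (simp add: norm_mult)
      also have "of_nat n * (z n - (1 + of_real c / of_nat n)) = of_nat n * (z n - 1) - of_real c"
        using n by (simp add: field_simps)
      finally show ?case .
    qed
  qed
  moreover have "(\<lambda>n. complex_of_real ((1 + c / real n) ^ n)) \<longlonglongrightarrow> of_real (exp c)"
    by (intro tendsto_of_real tendsto_exp_limit_sequentially)
  ultimately have "(\<lambda>n. (z n ^ n - of_real ((1 + c / real n) ^ n)) + of_real ((1 + c / real n) ^ n)) \<longlonglongrightarrow> 0 + of_real (exp c)"
    by (rule tendsto_add)
  then show ?thesis by simp
qed

lemma tendsto_one_minus_cos: "(\<lambda>n. real n * (1 - cos (c / sqrt (real n)))) \<longlonglongrightarrow> c\<^sup>2 / 2"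
  unfolding power2_eq_square by real_asymp

lemma std_normal_positive_part:
  "integrable std_normal_distribution (\<lambda>x. max x 0)"
  "(LINT x|std_normal_distribution. max x 0) = 1 / sqrt (2 * pi)"
proof -
  have i1: "integrable std_normal_distribution (\<lambda>x. x)"
    using integrable_std_normal_distribution_moment[of 1] by simp
  then have i2: "integrable std_normal_distribution (\<lambda>x. \<bar>x\<bar>)" by (rule integrable_abs)
  have e: "(\<lambda>x. max x 0) = (\<lambda>x::real. (x + \<bar>x\<bar>) / 2)" by (auto simp: fun_eq_iff)
  show "integrable std_normal_distribution (\<lambda>x. max x 0)"
    unfolding e using i1 i2 by auto
  have "(LINT x|std_normal_distribution. x) = 0"
    using integral_std_normal_distribution_moment_odd[of 1] by simp
  moreover have "(LINT x|std_normal_distribution. \<bar>x\<bar>) = sqrt (2 / pi)"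
    using std_normal_distribution_odd_moments_abs[of 0] by simp
  moreover have "(LINT x|std_normal_distribution. (x + \<bar>x\<bar>) / 2) =
     ((LINT x|std_normal_distribution. x) + (LINT x|std_normal_distribution. \<bar>x\<bar>)) / 2"
    using i1 i2 by simp
  moreover have "sqrt (2 / pi) / 2 = 1 / sqrt (2 * pi)"
    by (simp add: real_sqrt_divide real_sqrt_mult field_simps)
  ultimately show "(LINT x|std_normal_distribution. max x 0) = 1 / sqrt (2 * pi)"
    unfolding e by simp
qed

definition cfun :: "int pmf \<Rightarrow> real \<Rightarrow> complex" where
  "cfun M \<theta> = measure_pmf.expectation M (\<lambda>z. iexp (\<theta> * real_of_int z))"

lemma cfun_return: "cfun (return_pmf x) \<theta> = iexp (\<theta> * real_of_int x)"
  by (simp add: cfun_def)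

lemma cfun_bind: "cfun (M \<bind> N) \<theta> = measure_pmf.expectation M (\<lambda>x. cfun (N x) \<theta>)"
  unfolding cfun_def by (rule integral_bind_pmf_bounded_complex[where B=1]) simp

lemma cfun_shift: "cfun (map_pmf (\<lambda>z. z + y) M) \<theta> = iexp (\<theta> * real_of_int y) * cfun M \<theta>"
  by (simp add: cfun_def algebra_simps exp_add)

lemma norm_cfun_le: "norm (cfun M \<theta>) \<le> 1"
  unfolding cfun_def by (rule norm_expectation_le) simp

context keep_probability
begin

definition geo_cf :: "real \<Rightarrow> complex" where "geo_cf \<theta> = cfun (map_pmf int geo) \<theta>"
definition step_cf :: "real \<Rightarrow> complex" where "step_cf \<theta> = cfun (step_pmf p) \<theta>"

lemma one_minus_ne_0: "1 - of_real p * iexp \<theta> \<noteq> 0"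
proof
  assume "1 - of_real p * iexp \<theta> = 0"
  then have "norm (of_real p * iexp \<theta>) = 1" by simp
  then show False using p0 p1 by (simp add: norm_mult)
qed

text \<open>The recursive unfolding of the geometric law gives a linear equation for its
  characteristic function, solvable because \<open>p < 1\<close>.\<close>

lemma geo_cf_eq: "geo_cf \<theta> = of_real (1 - p) / (1 - of_real p * iexp \<theta>)"
proof -
  have "map_pmf int geo = bernoulli_pmf p \<bind> (\<lambda>b. if b then map_pmf (\<lambda>z. z + 1) (map_pmf int geo) else return_pmf 0)"
    by (subst geo_unfold) (auto simp: map_bind_pmf pmf.map_comp o_def add.commute intro!: bind_pmf_cong)
  then have "geo_cf \<theta> = measure_pmf.expectation (bernoulli_pmf p)
      (\<lambda>b. cfun (if b then map_pmf (\<lambda>z. z + 1) (map_pmf int geo) else return_pmf 0) \<theta>)"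
    unfolding geo_cf_def by (simp only: cfun_bind[symmetric])
  also have "\<dots> = of_real p * (iexp \<theta> * geo_cf \<theta>) + of_real (1 - p)"
    using p0 p1 cfun_shift[of 1 "map_pmf int geo" \<theta>]
    by (simp add: integral_measure_pmf[of UNIV] UNIV_bool cfun_return geo_cf_def scaleR_conv_of_real)
  finally show ?thesis using one_minus_ne_0[of \<theta>] by (simp add: field_simps)
qed

text \<open>Centring makes the numerator proportional to 1 - cos, of second order at 0. The limiting
  variance is read off from this form, without evaluating \<open>step_var\<close>.\<close>

lemma step_cf_eq:
  "step_cf \<theta> - 1 = - of_real (2 * p * (1 - cos \<theta>)) / (1 - of_real p * iexp \<theta>)"
proof -
  define e where "e = iexp \<theta>"
  have e0: "e \<noteq> 0" by (simp add: e_def)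
  have "step_cf \<theta> = of_real p * iexp (- \<theta>) + of_real (1 - p) * geo_cf \<theta>"
    unfolding step_cf_def step_pmf_def cfun_bind
    using p0 p1 by (simp add: integral_measure_pmf[of UNIV] UNIV_bool cfun_return geo_cf_def scaleR_conv_of_real)
  also have "iexp (- \<theta>) = inverse e" by (simp add: e_def exp_minus)
  finally have s: "step_cf \<theta> = of_real p * inverse e + of_real (1 - p) * (of_real (1 - p) / (1 - of_real p * e))"
    by (simp add: geo_cf_eq e_def)
  have "2 * of_real (cos \<theta>) = e + inverse e"
    by (simp add: e_def exp_minus[symmetric] complex_eq_iff Re_exp Im_exp)
  then have c: "of_real (2 * p * (1 - cos \<theta>)) = of_real p * (2 - e - inverse e)"
    by (simp add: algebra_simps)
  have d: "1 - of_real p * e \<noteq> 0" using one_minus_ne_0[of \<theta>] by (simp add: e_def)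
  show ?thesis unfolding s c e_def[symmetric] using d e0 by (simp add: field_simps)
qed

lemma cfun_chain: "cfun (chain p (\<lambda>z. z) t x) \<theta> = iexp (\<theta> * real_of_int x) * step_cf \<theta> ^ t"
proof (induction t arbitrary: x)
  case (Suc t)
  have "cfun (chain p (\<lambda>z. z) (Suc t) x) \<theta>
     = measure_pmf.expectation (step_pmf p) (\<lambda>k. (iexp (\<theta> * real_of_int x) * step_cf \<theta> ^ t) * iexp (\<theta> * real_of_int k))"
    by (simp add: cfun_bind Suc algebra_simps exp_add)
  also have "\<dots> = (iexp (\<theta> * real_of_int x) * step_cf \<theta> ^ t) * step_cf \<theta>"
    unfolding step_cf_def cfun_def
    by (rule integral_mult_right_zero)
  finally show ?case by simp
qed (simp add: cfun_return)

lemma cfun_free_X: "cfun (free_X a) \<theta> = geo_cf \<theta> * step_cf \<theta> ^ (a - 1)"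
proof -
  have "cfun (free_X a) \<theta> = measure_pmf.expectation geo (\<lambda>k. iexp (\<theta> * real k) * step_cf \<theta> ^ (a - 1))"
    by (simp add: free_X_def start_chain_def cfun_bind cfun_chain)
  also have "\<dots> = measure_pmf.expectation geo (\<lambda>k. iexp (\<theta> * real k)) * step_cf \<theta> ^ (a - 1)"
    by (rule integral_mult_left_zero)
  finally show ?thesis by (simp add: geo_cf_def cfun_def)
qed

definition diff_pmf :: "nat \<Rightarrow> int pmf" where
  "diff_pmf a = free_X a \<bind> (\<lambda>u. map_pmf (\<lambda>v. u - v) (free_Y a))"

lemma cfun_diff: "cfun (diff_pmf a) \<theta> = geo_cf \<theta> * step_cf \<theta> ^ (a - 1) * step_cf (- \<theta>) ^ a"
proof -
  have Y: "cfun (free_Y a) (- \<theta>) = step_cf (- \<theta>) ^ a"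
    by (simp add: free_Y_def cfun_chain)
  have "cfun (map_pmf (\<lambda>v. u - v) (free_Y a)) \<theta> = iexp (\<theta> * real_of_int u) * step_cf (- \<theta>) ^ a" for u
    unfolding Y[symmetric] by (simp add: cfun_def algebra_simps exp_diff exp_minus divide_inverse)
  then have "cfun (diff_pmf a) \<theta> = measure_pmf.expectation (free_X a) (\<lambda>u. iexp (\<theta> * real_of_int u) * step_cf (- \<theta>) ^ a)"
    by (simp add: diff_pmf_def cfun_bind)
  also have "\<dots> = cfun (free_X a) \<theta> * step_cf (- \<theta>) ^ a"
    unfolding cfun_def by (rule integral_mult_left_zero)
  finally show ?thesis by (simp add: cfun_free_X)
qed

text \<open>The standard deviation gained per row by the difference of the two walks.\<close>

definition scale :: real where "scale = 2 * sqrt (p / (1 - p))"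

lemma scale_pos: "0 < scale" using p0 p1 by (simp add: scale_def)

lemma step_cf_limit:
  assumes "\<theta> = (\<lambda>n. c / sqrt (real n))"
  shows "(\<lambda>n. step_cf (\<theta> n)) \<longlonglongrightarrow> 1" "(\<lambda>n. geo_cf (\<theta> n)) \<longlonglongrightarrow> 1"
    "(\<lambda>n. of_nat n * (step_cf (\<theta> n) - 1)) \<longlonglongrightarrow> of_real (- (c\<^sup>2 * (p / (1 - p))))"
proof -
  have th: "\<theta> \<longlonglongrightarrow> 0" unfolding assms by real_asymp
  have d: "(\<lambda>n. 1 - of_real p * iexp (\<theta> n)) \<longlonglongrightarrow> 1 - of_real p * exp (\<i> * of_real 0)"
    by (intro tendsto_intros th)
  have d0: "1 - of_real p * exp (\<i> * of_real 0) \<noteq> (0 :: complex)" using one_minus_ne_0[of 0] by simp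
  have "(\<lambda>n. - of_real (2 * p * (1 - cos (\<theta> n))) / (1 - of_real p * iexp (\<theta> n)))
    \<longlonglongrightarrow> - of_real (2 * p * (1 - cos 0)) / (1 - of_real p * exp (\<i> * of_real 0))"
    by (intro tendsto_intros th d0)
  then have "(\<lambda>n. step_cf (\<theta> n) - 1) \<longlonglongrightarrow> 0" unfolding step_cf_eq by simp
  then show "(\<lambda>n. step_cf (\<theta> n)) \<longlonglongrightarrow> 1" by (simp add: LIM_zero_iff)
  have "(\<lambda>n. geo_cf (\<theta> n)) \<longlonglongrightarrow> of_real (1 - p) / (1 - of_real p * exp (\<i> * of_real 0))"
    unfolding geo_cf_eq by (intro tendsto_intros th d0)
  also have "of_real (1 - p) / (1 - of_real p * exp (\<i> * of_real 0)) = (1 :: complex)"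
    using d0 by simp
  finally show "(\<lambda>n. geo_cf (\<theta> n)) \<longlonglongrightarrow> 1" .
  have "(\<lambda>n. - of_real (2 * p * (real n * (1 - cos (\<theta> n)))) / (1 - of_real p * iexp (\<theta> n)))
    \<longlonglongrightarrow> - of_real (2 * p * (c\<^sup>2 / 2)) / (1 - of_real p * exp (\<i> * of_real 0))"
    unfolding assms
    by (intro tendsto_divide tendsto_minus tendsto_of_real tendsto_mult tendsto_const tendsto_one_minus_cos d[unfolded assms] d0)
  also have "(\<lambda>n. - of_real (2 * p * (real n * (1 - cos (\<theta> n)))) / (1 - of_real p * iexp (\<theta> n)))
     = (\<lambda>n. of_nat n * (step_cf (\<theta> n) - 1))"
    unfolding step_cf_eq by (simp add: mult_ac)
  also have "- of_real (2 * p * (c\<^sup>2 / 2)) / (1 - of_real p * exp (\<i> * of_real 0)) = (of_real (- (c\<^sup>2 * (p / (1 - p)))) :: complex)"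
    by (simp add: mult_ac)
  finally show "(\<lambda>n. of_nat n * (step_cf (\<theta> n) - 1)) \<longlonglongrightarrow> of_real (- (c\<^sup>2 * (p / (1 - p))))" .
qed

text \<open>With this scaling each walk contributes exp (- t^2 / 4), the sign change of the argument
  being harmless in the limit. The geometric start contributes a factor tending to 1.\<close>

lemma cfun_diff_limit:
  "(\<lambda>n. cfun (diff_pmf n) (t / (scale * sqrt (real n)))) \<longlonglongrightarrow> of_real (exp (- (t\<^sup>2) / 2))"
proof -
  define c where "c = t / scale"
  define \<theta> where "\<theta> = (\<lambda>n. c / sqrt (real n))"
  have cc: "c\<^sup>2 * (p / (1 - p)) = t\<^sup>2 / 4"
    using p0 p1 by (simp add: c_def scale_def power_divide power_mult_distrib field_simps)
  have pw: "(\<lambda>n. step_cf (\<theta> n) ^ n) \<longlonglongrightarrow> of_real (exp (- (t\<^sup>2 / 4)))"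
    using step_cf_limit(3)[OF \<theta>_def] unfolding cc
    by (intro tendsto_power_exp_limit) (auto simp: step_cf_def norm_cfun_le)
  have "(\<lambda>n. - \<theta> n) = (\<lambda>n. (- c) / sqrt (real n))" by (simp add: \<theta>_def)
  from step_cf_limit(3)[OF this] have pw': "(\<lambda>n. step_cf (- \<theta> n) ^ n) \<longlonglongrightarrow> of_real (exp (- (t\<^sup>2 / 4)))"
    unfolding power2_minus cc by (intro tendsto_power_exp_limit) (auto simp: step_cf_def norm_cfun_le)
  \<comment> \<open>The missing step changes the power by at most the distance of one factor from 1,
    which vanishes.\<close>
  have "(\<lambda>n. step_cf (\<theta> n) ^ (n - 1) - step_cf (\<theta> n) ^ n) \<longlonglongrightarrow> 0"
  proof (rule Lim_null_comparison)
    show "(\<lambda>n. norm (1 - step_cf (\<theta> n))) \<longlonglongrightarrow> 0"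
      using tendsto_norm[OF tendsto_diff[OF tendsto_const[of 1] step_cf_limit(1)[OF \<theta>_def]]] by simp
    show "\<forall>\<^sub>F n in sequentially. norm (step_cf (\<theta> n) ^ (n - 1) - step_cf (\<theta> n) ^ n) \<le> norm (1 - step_cf (\<theta> n))"
      using eventually_gt_at_top[of 0]
    proof eventually_elim
      case (elim n)
      then have "step_cf (\<theta> n) ^ (n - 1) - step_cf (\<theta> n) ^ n = step_cf (\<theta> n) ^ (n - 1) * (1 - step_cf (\<theta> n))"
        by (cases n) (simp_all add: algebra_simps)
      moreover have "norm (step_cf (\<theta> n) ^ (n - 1)) \<le> 1"
        by (simp add: norm_power power_le_one step_cf_def norm_cfun_le)
      ultimately show ?case
        by (simp add: norm_mult mult_left_le_one_le)
    qed
  qed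
  from tendsto_add[OF this pw] have pw1: "(\<lambda>n. step_cf (\<theta> n) ^ (n - 1)) \<longlonglongrightarrow> of_real (exp (- (t\<^sup>2 / 4)))" by simp
  have "(\<lambda>n. geo_cf (\<theta> n) * step_cf (\<theta> n) ^ (n - 1) * step_cf (- \<theta> n) ^ n)
     \<longlonglongrightarrow> 1 * of_real (exp (- (t\<^sup>2 / 4))) * of_real (exp (- (t\<^sup>2 / 4)))"
    by (intro tendsto_mult pw1 pw' step_cf_limit(2)[OF \<theta>_def])
  also have "1 * of_real (exp (- (t\<^sup>2 / 4))) * of_real (exp (- (t\<^sup>2 / 4))) = complex_of_real (exp (- (t\<^sup>2) / 2))"
    unfolding mult_1 of_real_mult[symmetric] exp_add[symmetric] by simp
  also have "(\<lambda>n. geo_cf (\<theta> n) * step_cf (\<theta> n) ^ (n - 1) * step_cf (- \<theta> n) ^ n)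
     = (\<lambda>n. cfun (diff_pmf n) (t / (scale * sqrt (real n))))"
    by (simp add: cfun_diff \<theta>_def c_def)
  finally show ?thesis .
qed

lemma diff_weak_limit:
  fixes f :: "real \<Rightarrow> real"
  assumes "\<And>x. isCont f x" "\<And>x. \<bar>f x\<bar> \<le> B"
  shows "(\<lambda>n. measure_pmf.expectation (diff_pmf n) (\<lambda>z. f (real_of_int z / (scale * sqrt (real n)))))
     \<longlonglongrightarrow> (LINT x|std_normal_distribution. f x)"
proof -
  define M where "M n = distr (measure_pmf (diff_pmf n)) borel (\<lambda>z. real_of_int z / (scale * sqrt (real n)))" for n
  have M: "real_distribution (M n)" for n
    unfolding M_def by (rule prob_space.real_distribution_distr[OF measure_pmf.prob_space_axioms]) simp
  have "char (M n) t = cfun (diff_pmf n) (t / (scale * sqrt (real n)))" for n t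
    unfolding char_def M_def cfun_def by (subst integral_distr) (auto simp: mult_ac)
  then have "weak_conv_m M std_normal_distribution"
    using cfun_diff_limit by (intro levy_continuity M real_dist_normal_dist) (simp add: char_std_normal_distribution)
  from weak_conv_imp_integral_bdd_continuous_conv[OF M real_dist_normal_dist this, of f B]
  have "(\<lambda>n. integral\<^sup>L (M n) f) \<longlonglongrightarrow> integral\<^sup>L std_normal_distribution f"
    using assms by simp
  moreover have "f \<in> borel_measurable borel"
    using assms(1) by (intro borel_measurable_continuous_onI continuous_at_imp_continuous_on) auto
  then have "integral\<^sup>L (M n) f = measure_pmf.expectation (diff_pmf n) (\<lambda>z. f (real_of_int z / (scale * sqrt (real n))))" for n
    unfolding M_def by (subst integral_distr) auto
  ultimately show ?thesis by simp
qed

end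


section \<open>From weak convergence to convergence of means\<close>

text \<open>Weak convergence tests bounded functions only, and the positive part is unbounded. The
  loss from cutting at \<open>K\<close> is controlled by second moments, which replaces a uniform
  integrability argument.\<close>

lemma truncated_positive_part_error:
  fixes x K :: real
  assumes "0 < K"
  shows "\<bar>max x 0 - min (max x 0) K\<bar> \<le> x\<^sup>2 / K"
proof (cases "x \<le> K")
  case False
  then have "x * K \<le> x\<^sup>2" using assms by (simp add: power2_eq_square)
  then have "x \<le> x\<^sup>2 / K" using assms by (simp add: field_simps)
  then show ?thesis using False assms by auto
qed (use assms in \<open>auto simp: max_def min_def\<close>)

context keep_probability
begin

text \<open>The bound is free of \<open>n\<close>: second moments grow at most linearly, as does the
  square of \<open>scale * sqrt n\<close>.\<close>

lemma mean_pos_truncation: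
  assumes n: "0 < n" and K: "0 < K"
  shows "\<bar>mean_pos n / (scale * sqrt n)
    - measure_pmf.expectation (diff_pmf n) (\<lambda>z. min (max (real_of_int z / (scale * sqrt (real n))) 0) K)\<bar>
    \<le> 2 * var_bound / scale\<^sup>2 / K"
proof -
  define c where "c = scale * sqrt (real n)"
  have c: "0 < c" using scale_pos n by (simp add: c_def)
  let ?X = "free_X n" and ?Y = "free_Y n"
  let ?f = "\<lambda>x. min (max x 0) K"
  let ?h = "\<lambda>u v. max (real_of_int (u - v) / c) 0 - ?f (real_of_int (u - v) / c)"
  let ?q = "\<lambda>u. 2 * (real_of_int u)\<^sup>2 / (c\<^sup>2 * K)"
  note m = free_second_moments[of n]
  have q: "integrable (measure_pmf ?X) ?q" "integrable (measure_pmf ?Y) ?q" using m by auto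
  have fb: "\<bar>?f x\<bar> \<le> K" for x using K by auto
  have le: "\<bar>?h u v\<bar> \<le> 0 + ?q u + ?q v" for u v
  proof -
    have "\<bar>?h u v\<bar> \<le> (real_of_int (u - v) / c)\<^sup>2 / K"
      by (rule truncated_positive_part_error[OF K])
    also have "\<dots> = (real_of_int u - real_of_int v)\<^sup>2 / (c\<^sup>2 * K)" by (simp add: power_divide)
    also have "\<dots> \<le> (2 * (real_of_int u)\<^sup>2 + 2 * (real_of_int v)\<^sup>2) / (c\<^sup>2 * K)"
      using K by (intro divide_right_mono square_diff_le) auto
    finally show ?thesis by (simp add: add_divide_distrib)
  qed
  have le2: "\<bar>max (real_of_int (u - v) / c) 0\<bar> \<le> K + ?q u + ?q v" for u v
    using le[of u v] fb[of "real_of_int (u - v) / c"] by linarith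
  have f1: "integrable (measure_pmf M) (\<lambda>v. ?f (g v))" for M :: "int pmf" and g
    by (rule integrable_measure_pmf_bounded[where B=K]) (use fb in simp)
  have f2: "integrable (measure_pmf M) (\<lambda>u. measure_pmf.expectation M' (\<lambda>v. ?f (g u v)))" for M M' :: "int pmf" and g
    by (intro integrable_measure_pmf_bounded[where B=K] norm_expectation_le) (use fb in simp)
  note mx = iterated_expectation_bound[OF q le2]
  have "mean_pos n / c = measure_pmf.expectation ?X (\<lambda>u. measure_pmf.expectation ?Y (\<lambda>v. max (real_of_int (u - v) / c) 0))"
  proof -
    have "max (z / c) 0 = max z 0 / c" for z
      using c by (simp add: max_def field_simps)
    then show ?thesis by (simp add: mean_pos_def)
  qed
  moreover have "measure_pmf.expectation (diff_pmf n) (\<lambda>z. ?f (real_of_int z / c))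
     = measure_pmf.expectation ?X (\<lambda>u. measure_pmf.expectation ?Y (\<lambda>v. ?f (real_of_int (u - v) / c)))"
    unfolding diff_pmf_def by (subst integral_bind_pmf_bounded[where B=K]) (use fb in simp_all)
  ultimately have "mean_pos n / c - measure_pmf.expectation (diff_pmf n) (\<lambda>z. ?f (real_of_int z / c))
     = measure_pmf.expectation ?X (\<lambda>u. measure_pmf.expectation ?Y (?h u))"
    using mx(1,2) f1 f2 by (simp add: Bochner_Integration.integral_diff)
  then have "\<bar>mean_pos n / c - measure_pmf.expectation (diff_pmf n) (\<lambda>z. ?f (real_of_int z / c))\<bar>
     \<le> measure_pmf.expectation ?X ?q + measure_pmf.expectation ?Y ?q"
    using iterated_expectation_bound(3)[OF q le] by simp
  also have "\<dots> = 2 * (measure_pmf.expectation ?X (\<lambda>u. (real_of_int u)\<^sup>2)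
       + measure_pmf.expectation ?Y (\<lambda>u. (real_of_int u)\<^sup>2)) / (c\<^sup>2 * K)"
    by (simp add: add_divide_distrib)
  also have "\<dots> \<le> 2 * (var_bound * n) / (c\<^sup>2 * K)"
    using m(3) var_bound_ge[of n n] n K by (intro divide_right_mono mult_left_mono) auto
  also have "\<dots> = 2 * var_bound / scale\<^sup>2 / K"
    using n by (simp add: c_def power_mult_distrib)
  finally show ?thesis by (simp only: c_def)
qed

lemma mean_pos_limit: "(\<lambda>n. mean_pos n / (scale * sqrt n)) \<longlonglongrightarrow> 1 / sqrt (2 * pi)"
proof (rule LIMSEQ_I)
  fix \<epsilon> :: real assume e: "0 < \<epsilon>"
  define C where "C = 2 * var_bound / scale\<^sup>2"
  have C: "0 \<le> C" using var_bound_nonneg by (simp add: C_def)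
  \<comment> \<open>Makes C / K + 1 / K equal to half of \<open>\<epsilon>\<close>: C / K is the
    truncation error of the walks, 1 / K that of the normal law with second moment 1.\<close>
  define K where "K = 2 * (C + 1) / \<epsilon>"
  have K: "0 < K" using e C by (simp add: K_def)
  let ?f = "\<lambda>x. min (max x 0) K"
  have fb: "\<bar>?f x\<bar> \<le> K" for x using K by auto
  have cont: "isCont ?f x" for x by (intro continuous_intros)
  have "(\<lambda>n. measure_pmf.expectation (diff_pmf n) (\<lambda>z. ?f (real_of_int z / (scale * sqrt (real n)))))
     \<longlonglongrightarrow> (LINT x|std_normal_distribution. ?f x)"
    using cont fb by (rule diff_weak_limit)
  from LIMSEQ_D[OF this, of "\<epsilon> / 2"] e obtain N where N: "\<And>n. n \<ge> N \<Longrightarrow>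
    \<bar>measure_pmf.expectation (diff_pmf n) (\<lambda>z. ?f (real_of_int z / (scale * sqrt (real n)))) - (LINT x|std_normal_distribution. ?f x)\<bar> < \<epsilon> / 2"
    by auto
  interpret N: real_distribution std_normal_distribution by (rule real_dist_normal_dist)
  have norm: "\<bar>1 / sqrt (2 * pi) - (LINT x|std_normal_distribution. ?f x)\<bar> \<le> 1 / K"
  proof -
    have i: "integrable std_normal_distribution ?f"
      using fb by (intro N.integrable_const_bound[where B=K]) auto
    have sq: "integrable std_normal_distribution (\<lambda>x. x\<^sup>2)" "(LINT x|std_normal_distribution. x\<^sup>2) = 1"
      using std_normal_distribution_even_moments[of 1] by simp_all
    have "1 / sqrt (2 * pi) - (LINT x|std_normal_distribution. ?f x) = (LINT x|std_normal_distribution. max x 0 - ?f x)"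
      using i std_normal_positive_part by simp
    also have "\<bar>\<dots>\<bar> \<le> (LINT x|std_normal_distribution. \<bar>max x 0 - ?f x\<bar>)"
      by (rule integral_abs_bound)
    also have "\<dots> \<le> (LINT x|std_normal_distribution. x\<^sup>2 / K)"
      using i sq std_normal_positive_part truncated_positive_part_error[OF K] by (intro integral_mono) auto
    also have "\<dots> = 1 / K" using sq by simp
    finally show ?thesis .
  qed
  have "norm (mean_pos n / (scale * sqrt n) - 1 / sqrt (2 * pi)) < \<epsilon>" if n: "n \<ge> max 1 N" for n
  proof -
    have "\<bar>mean_pos n / (scale * sqrt n)
      - measure_pmf.expectation (diff_pmf n) (\<lambda>z. ?f (real_of_int z / (scale * sqrt (real n))))\<bar> \<le> C / K"
      using mean_pos_truncation[of n K] n K by (simp add: C_def)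
    moreover have "C / K + 1 / K = \<epsilon> / 2"
    proof -
      have "C + 1 \<noteq> 0" using C by simp
      then show ?thesis unfolding add_divide_distrib[symmetric] by (simp add: K_def distrib_left[symmetric] del: distrib_left_numeral)
    qed
    moreover from n have "N \<le> n" by simp
    note N[OF this]
    ultimately show ?thesis using norm unfolding real_norm_def by linarith
  qed
  then show "\<exists>no. \<forall>n\<ge>no. norm (mean_pos n / (scale * sqrt n) - 1 / sqrt (2 * pi)) < \<epsilon>" by blast
qed

end

section \<open>Summation over the rows\<close>

text \<open>For consecutive square roots, (y - x) * (x + y) = 1. Multiplying the difference of cubes
  by x + y removes the roots and leaves quadratic inequalities, the discrete form of the derivative
  of t powr (3/2).\<close>

lemma sqrt_increment_bounds:
  fixes x y :: real
  assumes "0 \<le> x" "x \<le> y" "y\<^sup>2 = x\<^sup>2 + 1"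
  shows "3 / 2 * x \<le> y ^ 3 - x ^ 3" "y ^ 3 - x ^ 3 \<le> 3 / 2 * y"
proof -
  have pos: "0 < x + y" using assms by (cases "y = 0") auto
  have d: "(y - x) * (x + y) = 1" using assms(3) by (simp add: power2_eq_square algebra_simps)
  have "(y ^ 3 - x ^ 3) * (x + y) = ((y - x) * (x + y)) * (y\<^sup>2 + x * y + x\<^sup>2)"
    by (simp add: power2_eq_square power3_eq_cube algebra_simps)
  then have e: "(y ^ 3 - x ^ 3) * (x + y) = y\<^sup>2 + x * y + x\<^sup>2" by (simp add: d)
  have "0 \<le> (y - x) * (2 * y + x)" "0 \<le> (y - x) * (y + 2 * x)" using assms by auto
  then have "3 / 2 * x * (x + y) \<le> (y ^ 3 - x ^ 3) * (x + y)" "(y ^ 3 - x ^ 3) * (x + y) \<le> 3 / 2 * y * (x + y)"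
    unfolding e by (simp_all add: power2_eq_square algebra_simps)
  then show "3 / 2 * x \<le> y ^ 3 - x ^ 3" "y ^ 3 - x ^ 3 \<le> 3 / 2 * y"
    using pos by (simp_all only: mult_le_cancel_right_pos)
qed

lemma sum_sqrt_bounds:
  "(\<Sum>a<n. sqrt (real a)) \<le> 2 / 3 * sqrt (real n) ^ 3"
  "2 / 3 * sqrt (real n) ^ 3 - sqrt (real n) \<le> (\<Sum>a<n. sqrt (real a))"
proof -
  have b: "3 / 2 * sqrt (real n) \<le> sqrt (real (Suc n)) ^ 3 - sqrt (real n) ^ 3"
    "sqrt (real (Suc n)) ^ 3 - sqrt (real n) ^ 3 \<le> 3 / 2 * sqrt (real (Suc n))" for n
    by (rule sqrt_increment_bounds; simp)+
  show "(\<Sum>a<n. sqrt (real a)) \<le> 2 / 3 * sqrt (real n) ^ 3"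
  proof (induction n)
    case (Suc n)
    then show ?case using b(1)[of n] by simp
  qed simp
  show "2 / 3 * sqrt (real n) ^ 3 - sqrt (real n) \<le> (\<Sum>a<n. sqrt (real a))"
  proof (induction n)
    case (Suc n)
    then show ?case using b(2)[of n] by simp
  qed simp
qed

text \<open>A Cesaro argument with weights sqrt a: the finitely many early terms vanish after
  division, and the later ones deviate by a small multiple of the weight.\<close>

lemma sum_over_sqrt_limit:
  assumes lim: "(\<lambda>n. c n / sqrt (real n)) \<longlonglongrightarrow> \<kappa>" and c0: "c 0 = 0"
  shows "(\<lambda>n. (\<Sum>a<n. c a) / sqrt (real n) ^ 3) \<longlonglongrightarrow> 2 / 3 * \<kappa>"
proof -
  define S where "S n = (\<Sum>a<n. sqrt (real a))" for n
  have S: "(\<lambda>n. S n / sqrt (real n) ^ 3) \<longlonglongrightarrow> 2 / 3"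
  proof (rule tendsto_sandwich)
    show "\<forall>\<^sub>F n in sequentially. S n / sqrt (real n) ^ 3 \<le> 2 / 3"
      using eventually_gt_at_top[of 0] by eventually_elim (use sum_sqrt_bounds(1) in \<open>simp add: S_def field_simps\<close>)
    show "\<forall>\<^sub>F n in sequentially. 2 / 3 - 1 / real n \<le> S n / sqrt (real n) ^ 3"
      using eventually_gt_at_top[of 0]
    proof eventually_elim
      case (elim n)
      have "2 / 3 - 1 / real n = (2 / 3 * sqrt (real n) ^ 3 - sqrt (real n)) / sqrt (real n) ^ 3"
        using elim by (simp add: diff_divide_distrib power3_eq_cube)
      also have "\<dots> \<le> S n / sqrt (real n) ^ 3"
        unfolding S_def by (intro divide_right_mono sum_sqrt_bounds) auto
      finally show ?case .
    qed
    show "(\<lambda>n. 2 / 3 - 1 / real n) \<longlonglongrightarrow> 2 / 3" by real_asymp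
  qed auto
  have "(\<lambda>n. (\<Sum>a<n. c a - \<kappa> * sqrt (real a)) / sqrt (real n) ^ 3) \<longlonglongrightarrow> 0"
  proof (rule LIMSEQ_I)
    fix \<epsilon> :: real assume e: "0 < \<epsilon>"
    from LIMSEQ_D[OF lim, of "\<epsilon> / 2"] e obtain N where N: "\<And>n. n \<ge> N \<Longrightarrow> \<bar>c n / sqrt (real n) - \<kappa>\<bar> < \<epsilon> / 2"
      by auto
    define B where "B = (\<Sum>a<N. \<bar>c a - \<kappa> * sqrt (real a)\<bar>)"
    have term_le: "\<bar>c a - \<kappa> * sqrt (real a)\<bar> \<le> (if a < N then \<bar>c a - \<kappa> * sqrt (real a)\<bar> else 0) + \<epsilon> / 2 * sqrt (real a)" for a
    \<comment> \<open>At 0 the quotient in \<open>lim\<close> is 0 by the convention on division and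
      says nothing about \<open>c 0\<close>; there \<open>c0\<close> makes the left side
      zero.\<close>
    proof (cases "a < N \<or> a = 0")
      case False
      then have "c a - \<kappa> * sqrt (real a) = (c a / sqrt (real a) - \<kappa>) * sqrt (real a)"
        by (simp add: field_simps)
      then have "\<bar>c a - \<kappa> * sqrt (real a)\<bar> = \<bar>c a / sqrt (real a) - \<kappa>\<bar> * sqrt (real a)"
        by (simp add: abs_mult)
      also have "\<dots> \<le> \<epsilon> / 2 * sqrt (real a)"
        using N[of a] False by (intro mult_right_mono) auto
      finally show ?thesis using False by simp
    qed (use e c0 in auto)
    have bound: "\<bar>\<Sum>a<n. c a - \<kappa> * sqrt (real a)\<bar> \<le> B + \<epsilon> / 2 * (2 / 3 * sqrt (real n) ^ 3)" for n
    proof -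
      have "\<bar>\<Sum>a<n. c a - \<kappa> * sqrt (real a)\<bar> \<le> (\<Sum>a<n. \<bar>c a - \<kappa> * sqrt (real a)\<bar>)"
        by (rule sum_abs)
      also have "\<dots> \<le> (\<Sum>a<n. (if a < N then \<bar>c a - \<kappa> * sqrt (real a)\<bar> else 0) + \<epsilon> / 2 * sqrt (real a))"
        by (intro sum_mono term_le)
      also have "\<dots> = (\<Sum>a<n. if a < N then \<bar>c a - \<kappa> * sqrt (real a)\<bar> else 0) + \<epsilon> / 2 * (\<Sum>a<n. sqrt (real a))"
        by (simp add: sum.distrib sum_distrib_left)
      also have "(\<Sum>a<n. if a < N then \<bar>c a - \<kappa> * sqrt (real a)\<bar> else 0) = (\<Sum>a\<in>{..<n} \<inter> {..<N}. \<bar>c a - \<kappa> * sqrt (real a)\<bar>)"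
        by (simp add: sum.inter_restrict)
      also have "\<dots> \<le> B" unfolding B_def by (intro sum_mono2) auto
      also have "\<epsilon> / 2 * (\<Sum>a<n. sqrt (real a)) \<le> \<epsilon> / 2 * (2 / 3 * sqrt (real n) ^ 3)"
        using e by (intro mult_left_mono sum_sqrt_bounds) auto
      finally show ?thesis by simp
    qed
    have "(\<lambda>n. B / sqrt (real n) ^ 3) \<longlonglongrightarrow> 0" by real_asymp
    from LIMSEQ_D[OF this, of "\<epsilon> / 2"] e obtain N' where N': "\<And>n. n \<ge> N' \<Longrightarrow> \<bar>B / sqrt (real n) ^ 3\<bar> < \<epsilon> / 2"
      by auto
    have "norm ((\<Sum>a<n. c a - \<kappa> * sqrt (real a)) / sqrt (real n) ^ 3 - 0) < \<epsilon>" if n: "n \<ge> max 1 N'" for n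
    proof -
      have "norm ((\<Sum>a<n. c a - \<kappa> * sqrt (real a)) / sqrt (real n) ^ 3 - 0)
        \<le> (B + \<epsilon> / 2 * (2 / 3 * sqrt (real n) ^ 3)) / sqrt (real n) ^ 3"
        using bound[of n] by (simp add: divide_right_mono)
      also have "\<dots> = B / sqrt (real n) ^ 3 + \<epsilon> / 3"
        using n by (simp add: add_divide_distrib)
      also have "\<dots> < \<epsilon>"
        using abs_ge_self[of "B / sqrt (real n) ^ 3"] N'[of n] n e by linarith
      finally show ?thesis .
    qed
    then show "\<exists>no. \<forall>n\<ge>no. norm ((\<Sum>a<n. c a - \<kappa> * sqrt (real a)) / sqrt (real n) ^ 3 - 0) < \<epsilon>" by blast
  qed
  from tendsto_add[OF this tendsto_mult[OF tendsto_const[of \<kappa>] S]]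
  show ?thesis
    by (simp add: sum_subtractf S_def sum_distrib_left[symmetric] diff_divide_distrib mult_ac)
qed

theorem mainTheorem2:
  fixes p :: real
  assumes "0 < p" and "p < 1"
  shows "(\<lambda>n. measure_pmf.expectation (random_perm p n) (\<lambda>v. real (inversions n v)))
           \<sim>[at_top]
         (\<lambda>n. 2 * sqrt 2 / (3 * sqrt pi) * sqrt (p / (1 - p)) * real n powr (3 / 2))"
proof -
  interpret keep_probability p using assms by unfold_locales
  let ?E = "\<lambda>n. measure_pmf.expectation (random_perm p n) (\<lambda>v. real (inversions n v))"
  \<comment> \<open>There is no row 0, yet \<open>mean_pos 0\<close> is the geometric mean p / (1 -
    p), because 0 - 1 = 0 on naturals leaves the geometric start. Setting the term to 0 lets the sum
    range over all a < n.\<close>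
  define c where "c a = (if a = 0 then 0 else mean_pos a)" for a
  let ?\<kappa> = "2 * sqrt 2 / (3 * sqrt pi) * sqrt (p / (1 - p))"
  have k: "2 / 3 * (scale * (1 / sqrt (2 * pi))) = ?\<kappa>"
    by (simp add: scale_def real_sqrt_mult field_simps)
  have "(\<lambda>n. scale * (mean_pos n / (scale * sqrt n))) \<longlonglongrightarrow> scale * (1 / sqrt (2 * pi))"
    by (intro tendsto_mult mean_pos_limit tendsto_const)
  moreover have "\<forall>\<^sub>F n in sequentially. scale * (mean_pos n / (scale * sqrt n)) = c n / sqrt (real n)"
    using eventually_gt_at_top[of 0] by eventually_elim (use scale_pos in \<open>simp add: c_def\<close>)
  ultimately have "(\<lambda>n. c n / sqrt (real n)) \<longlonglongrightarrow> scale * (1 / sqrt (2 * pi))"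
    by (rule Lim_transform_eventually)
  then have main: "(\<lambda>n. (\<Sum>a<n. c a) / sqrt (real n) ^ 3) \<longlonglongrightarrow> ?\<kappa>"
    unfolding k[symmetric] by (rule sum_over_sqrt_limit) (simp add: c_def)
  have sum: "(\<Sum>a\<in>{1..<n}. mean_pos a) = (\<Sum>a<n. c a)" for n
    by (rule sum.mono_neutral_cong_left) (auto simp: c_def)
  have "(\<lambda>n. (?E n - (\<Sum>a<n. c a)) / sqrt (real n) ^ 3) \<longlonglongrightarrow> 0"
  proof (rule Lim_null_comparison)
    show "(\<lambda>n. (3 / 2 * real n + 27 * (var_bound * real n) * root 3 (real n)) / sqrt (real n) ^ 3) \<longlonglongrightarrow> 0"
      by real_asymp
    show "\<forall>\<^sub>F n in sequentially. norm ((?E n - (\<Sum>a<n. c a)) / sqrt (real n) ^ 3)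
      \<le> (3 / 2 * real n + 27 * (var_bound * real n) * root 3 (real n)) / sqrt (real n) ^ 3"
      using expectation_inversions_approx unfolding sum by (simp add: divide_right_mono)
  qed
  from tendsto_add[OF this main] have "(\<lambda>n. ?E n / sqrt (real n) ^ 3) \<longlonglongrightarrow> ?\<kappa>"
    by (simp add: diff_divide_distrib)
  moreover have "sqrt (real n) ^ 3 = real n powr (3 / 2)" for n
    by (cases "n = 0") (simp_all add: powr_half_sqrt[symmetric] powr_power)
  ultimately have "(\<lambda>n. ?E n / real n powr (3 / 2)) \<longlonglongrightarrow> ?\<kappa>" by simp
  from tendsto_divide[OF this tendsto_const[of ?\<kappa>]]
  have "(\<lambda>n. ?E n / (?\<kappa> * real n powr (3 / 2))) \<longlonglongrightarrow> 1"
    using assms by (simp add: mult_ac)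
  then show ?thesis by (rule asymp_equivI'[rotated]) 
qed

end
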